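(* Let $G$ be a three-dimensional Lie group with a bi-invariant metric $\langle\,,\rangle$ and let $\alpha:I\subset\mathbb{R}\to G$ be a unit speed curve with Frenet apparatus $(T,N,B,\varkappa,\tau)$ and harmonic curvature function $H=\frac{\tau-\tau_G}{\varkappa}$. Then $\alpha$ is a slant helix if and only if $$\sigma_N=\frac{\varkappa(1+H^2)^{3/2}}{H'}=\tan\theta$$ is a constant (which includes that $H'$ vanishes nowhere, so that the quotient is defined), where $\theta\neq\frac{\pi}{2}$ is a constant.
   Context: $\mathfrak{g}$ is the Lie algebra of left-invariant vector fields of $G$ and $D$ is the Levi-Civita connection, so $D_XY=\frac12[X,Y]$ for $X,Y\in\mathfrak{g}$. Let $\{X_1,X_2,X_3\}$ be an orthonormal basis of $\mathfrak{g}$. Vector fields along $\alpha$ are written $W=\sum_i w_iX_i$, $Z=\sum_i z_iX_i$ with smooth $w_i,z_i:I\to\mathbb{R}$; one sets $\dot W=\sum_i w_i'X_i$ and $[W,Z]=\sum_{i,j}w_iz_j[X_i,X_j]$, and $D_{\alpha'}W=\dot W+\frac12[T,W]$ with $T=\alpha'$. The Frenet apparatus of a unit speed curve consists of the positively oriented orthonormal frame $T=\alpha',N,B=T\times N$, the curvature $\varkappa=\|\dot T\|>0$ and the torsion $\tau$, with $D_TT=\varkappa N$, $D_TN=-\varkappa T+\tau B$, $D_TB=-\tau N$. One sets $\tau_G=\frac12\langle[T,N],B\rangle$. Prime denotes differentiation with respect to the arc length $s$. Slant helix: $\alpha$ is a slant helix if there is a unit length left-invariant vector field $X\in\mathfrak{g}$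 and a constant angle $\theta\ne\frac{\pi}{2}$ such that $\langle N(s),X\rangle=\cos\theta$ for all $s\in I$. *)

theory Defs
  imports "HOL-Analysis.Analysis" "HOL-Algebra.Group"
begin

section \<open>Smooth maps\<close>

text \<open>Only meant for open sets \<open>S\<close>: all iterated directional derivatives up to order \<open>n\<close>
  exist and are continuous.\<close>

primrec Ck_on ::
  "nat \<Rightarrow> 'a::euclidean_space set \<Rightarrow> ('a \<Rightarrow> 'b::euclidean_space) \<Rightarrow> bool" where
  "Ck_on 0 S f \<longleftrightarrow> continuous_on S f"
| "Ck_on (Suc n) S f \<longleftrightarrow>
     (\<forall>x\<in>S. f differentiable (at x)) \<and> (\<forall>v. Ck_on n S (\<lambda>x. frechet_derivative f (at x) v))"

definition smooth_on ::
  "'a::euclidean_space set \<Rightarrow> ('a \<Rightarrow> 'b::euclidean_space) \<Rightarrow> bool" where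
  "smooth_on S f \<longleftrightarrow> (\<forall>n. Ck_on n S f)"

type_synonym ('p, 'e) atlas = "('p set \<times> ('p \<Rightarrow> 'e)) set"

definition smooth_atlas ::
  "('p::topological_space, 'e::euclidean_space) atlas \<Rightarrow> bool" where
  "smooth_atlas \<A> \<longleftrightarrow>
     (\<forall>(U, \<phi>)\<in>\<A>. open U \<and> open (\<phi> ` U) \<and> (\<exists>\<psi>. homeomorphism U (\<phi> ` U) \<phi> \<psi>)) \<and>
     (\<Union>(U, \<phi>)\<in>\<A>. U) = UNIV \<and>
     (\<forall>(U, \<phi>)\<in>\<A>. \<forall>(V, \<psi>)\<in>\<A>. smooth_on (\<phi> ` (U \<inter> V)) (\<psi> \<circ> inv_into U \<phi>))"

definition std_atlas :: "('e::euclidean_space, 'e) atlas" where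
  "std_atlas = {(UNIV, id)}"

definition prod_atlas ::
  "('p, 'e) atlas \<Rightarrow> ('q, 'f) atlas \<Rightarrow> ('p \<times> 'q, 'e \<times> 'f) atlas" where
  "prod_atlas \<A> \<B> = {(U \<times> V, map_prod \<phi> \<psi>) | U \<phi> V \<psi>. (U, \<phi>) \<in> \<A> \<and> (V, \<psi>) \<in> \<B>}"

definition smooth_map ::
  "('p::topological_space, 'e::euclidean_space) atlas \<Rightarrow>
   ('q::topological_space, 'f::euclidean_space) atlas \<Rightarrow> 'p set \<Rightarrow> ('p \<Rightarrow> 'q) \<Rightarrow> bool" where
  "smooth_map \<A> \<B> S f \<longleftrightarrow> open S \<and> continuous_on S f \<and>
     (\<forall>(U, \<phi>)\<in>\<A>. \<forall>(V, \<psi>)\<in>\<B>.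
        smooth_on (\<phi> ` (S \<inter> U \<inter> f -` V)) (\<psi> \<circ> f \<circ> inv_into U \<phi>))"

section \<open>Tangent vectors and vector fields\<close>

text \<open>A tangent vector at \<open>p\<close> is the directional derivative along a smooth curve through \<open>p\<close>,
  as a functional on the real functions that are smooth near \<open>p\<close>.  It takes the dummy value \<open>0\<close>
  on all other functions, so that equality of tangent vectors is equality of functionals.\<close>

type_synonym 'p tvec = "('p \<Rightarrow> real) \<Rightarrow> real"
type_synonym 'p vfield = "'p \<Rightarrow> 'p tvec"

definition smooth_near ::
  "('p::topological_space, 'e::euclidean_space) atlas \<Rightarrow> 'p \<Rightarrow> ('p \<Rightarrow> real) \<Rightarrow> bool" where
  "smooth_near \<A> p f \<longleftrightarrow> (\<exists>S. p \<in> S \<and> smooth_map \<A> std_atlas S f)"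

definition velocity ::
  "('p::topological_space, 'e::euclidean_space) atlas \<Rightarrow> (real \<Rightarrow> 'p) \<Rightarrow> real \<Rightarrow> 'p tvec" where
  "velocity \<A> \<gamma> s = (\<lambda>f. if smooth_near \<A> (\<gamma> s) f then deriv (f \<circ> \<gamma>) s else 0)"

definition tangent_space ::
  "('p::topological_space, 'e::euclidean_space) atlas \<Rightarrow> 'p \<Rightarrow> 'p tvec set" where
  "tangent_space \<A> p =
     {velocity \<A> \<gamma> 0 | \<gamma> J. 0 \<in> J \<and> smooth_map std_atlas \<A> J \<gamma> \<and> \<gamma> 0 = p}"

definition smooth_vector_field ::
  "('p::topological_space, 'e::euclidean_space) atlas \<Rightarrow> 'p vfield \<Rightarrow> bool" where
  "smooth_vector_field \<A> X \<longleftrightarrow> (\<forall>p. X p \<in> tangent_space \<A> p) \<and>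
     (\<forall>S f. smooth_map \<A> std_atlas S f \<longrightarrow> smooth_map \<A> std_atlas S (\<lambda>p. X p f))"

definition lie_bracket ::
  "('p::topological_space, 'e::euclidean_space) atlas \<Rightarrow> 'p vfield \<Rightarrow> 'p vfield \<Rightarrow> 'p vfield" where
  "lie_bracket \<A> X Y = (\<lambda>p f.
     if smooth_near \<A> p f then X p (\<lambda>q. Y q f) - Y p (\<lambda>q. X q f) else 0)"

definition riemannian_metric ::
  "('p::topological_space, 'e::euclidean_space) atlas \<Rightarrow>
   ('p \<Rightarrow> 'p tvec \<Rightarrow> 'p tvec \<Rightarrow> real) \<Rightarrow> bool" where
  "riemannian_metric \<A> m \<longleftrightarrow>
     (\<forall>p. \<forall>u\<in>tangent_space \<A> p. \<forall>v\<in>tangent_space \<A> p. m p u v = m p v u) \<and>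
     (\<forall>p. \<forall>u\<in>tangent_space \<A> p. \<forall>v\<in>tangent_space \<A> p. \<forall>w\<in>tangent_space \<A> p. \<forall>a b.
        m p (\<lambda>f. a * u f + b * v f) w = a * m p u w + b * m p v w) \<and>
     (\<forall>p. \<forall>u\<in>tangent_space \<A> p. u \<noteq> (\<lambda>f. 0) \<longrightarrow> m p u u > 0) \<and>
     (\<forall>X Y. smooth_vector_field \<A> X \<longrightarrow> smooth_vector_field \<A> Y \<longrightarrow>
        smooth_map \<A> std_atlas UNIV (\<lambda>p. m p (X p) (Y p)))"

text \<open>\<open>D X Y\<close> is the covariant derivative of \<open>Y\<close> in direction \<open>X\<close>; the last two conditions are
  vanishing torsion and compatibility with the metric.\<close>

definition levi_civita ::
  "('p::topological_space, 'e::euclidean_space) atlas \<Rightarrow>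
   ('p \<Rightarrow> 'p tvec \<Rightarrow> 'p tvec \<Rightarrow> real) \<Rightarrow> ('p vfield \<Rightarrow> 'p vfield \<Rightarrow> 'p vfield) \<Rightarrow> bool" where
  "levi_civita \<A> m D \<longleftrightarrow>
     (\<forall>X Y. smooth_vector_field \<A> X \<longrightarrow> smooth_vector_field \<A> Y \<longrightarrow>
        smooth_vector_field \<A> (D X Y)) \<and>
     (\<forall>X Y Z. smooth_vector_field \<A> X \<longrightarrow> smooth_vector_field \<A> Y \<longrightarrow>
        smooth_vector_field \<A> Z \<longrightarrow>
        D (\<lambda>p f. X p f + Y p f) Z = (\<lambda>p f. D X Z p f + D Y Z p f) \<and>
        D X (\<lambda>p f. Y p f + Z p f) = (\<lambda>p f. D X Y p f + D X Z p f)) \<and>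
     (\<forall>X Y h. smooth_vector_field \<A> X \<longrightarrow> smooth_vector_field \<A> Y \<longrightarrow>
        smooth_map \<A> std_atlas UNIV h \<longrightarrow>
        D (\<lambda>p f. h p * X p f) Y = (\<lambda>p f. h p * D X Y p f) \<and>
        D X (\<lambda>p f. h p * Y p f) = (\<lambda>p f. X p h * Y p f + h p * D X Y p f)) \<and>
     (\<forall>X Y. smooth_vector_field \<A> X \<longrightarrow> smooth_vector_field \<A> Y \<longrightarrow>
        (\<lambda>p f. D X Y p f - D Y X p f) = lie_bracket \<A> X Y) \<and>
     (\<forall>X Y Z. smooth_vector_field \<A> X \<longrightarrow> smooth_vector_field \<A> Y \<longrightarrow>
        smooth_vector_field \<A> Z \<longrightarrow>
        (\<forall>p. X p (\<lambda>q. m q (Y q) (Z q)) = m p (D X Y p) (Z p) + m p (Y p) (D X Z p)))"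

section \<open>Lie groups with a bi-invariant metric\<close>

text \<open>The group lives on the whole type \<open>'g\<close>, whose topology is the manifold topology.
  The dimension is that of the model space \<open>'e\<close> of the atlas.\<close>

definition lie_group ::
  "'g::{t2_space,second_countable_topology} monoid \<Rightarrow> ('g, 'e::euclidean_space) atlas \<Rightarrow> bool" where
  "lie_group G \<A> \<longleftrightarrow> group G \<and> carrier G = UNIV \<and> smooth_atlas \<A> \<and>
     smooth_map (prod_atlas \<A> \<A>) \<A> UNIV (\<lambda>(x, y). x \<otimes>\<^bsub>G\<^esub> y) \<and>
     smooth_map \<A> \<A> UNIV (\<lambda>x. inv\<^bsub>G\<^esub> x)"

text \<open>The differential of a diffeomorphism \<open>F\<close>.  Below \<open>F\<close> is always a left or right translation;
  for such \<open>F\<close> the dummy value convention of tangent vectors is preserved.\<close>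

definition diffeo_push :: "('p \<Rightarrow> 'q) \<Rightarrow> 'p tvec \<Rightarrow> 'q tvec" where
  "diffeo_push F v = (\<lambda>f. v (f \<circ> F))"

definition lie_algebra ::
  "'g::{t2_space,second_countable_topology} monoid \<Rightarrow> ('g, 'e::euclidean_space) atlas \<Rightarrow>
   'g vfield set" where
  "lie_algebra G \<A> = {X. smooth_vector_field \<A> X \<and>
     (\<forall>a p. X (a \<otimes>\<^bsub>G\<^esub> p) = diffeo_push (\<lambda>x. a \<otimes>\<^bsub>G\<^esub> x) (X p))}"

definition bi_invariant_metric ::
  "'g::{t2_space,second_countable_topology} monoid \<Rightarrow> ('g, 'e::euclidean_space) atlas \<Rightarrow>
   ('g \<Rightarrow> 'g tvec \<Rightarrow> 'g tvec \<Rightarrow> real) \<Rightarrow> bool" where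
  "bi_invariant_metric G \<A> m \<longleftrightarrow> riemannian_metric \<A> m \<and>
     (\<forall>a p. \<forall>u\<in>tangent_space \<A> p. \<forall>v\<in>tangent_space \<A> p.
        m (a \<otimes>\<^bsub>G\<^esub> p) (diffeo_push (\<lambda>x. a \<otimes>\<^bsub>G\<^esub> x) u) (diffeo_push (\<lambda>x. a \<otimes>\<^bsub>G\<^esub> x) v)
          = m p u v \<and>
        m (p \<otimes>\<^bsub>G\<^esub> a) (diffeo_push (\<lambda>x. x \<otimes>\<^bsub>G\<^esub> a) u) (diffeo_push (\<lambda>x. x \<otimes>\<^bsub>G\<^esub> a) v)
          = m p u v)"

text \<open>The inner product that the metric induces on the Lie algebra, via the tangent space at the
  unit.\<close>

definition lie_inner ::
  "'g monoid \<Rightarrow> ('g \<Rightarrow> 'g tvec \<Rightarrow> 'g tvec \<Rightarrow> real) \<Rightarrow> 'g vfield \<Rightarrow> 'g vfield \<Rightarrow> real" where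
  "lie_inner G m X Y = m \<one>\<^bsub>G\<^esub> (X \<one>\<^bsub>G\<^esub>) (Y \<one>\<^bsub>G\<^esub>)"

text \<open>The vector \<open>\<Sum>i. c\<^sub>i E\<^sub>i\<close> at the point \<open>p\<close>.\<close>

definition lincomb :: "(3 \<Rightarrow> 'g vfield) \<Rightarrow> real ^ 3 \<Rightarrow> 'g vfield" where
  "lincomb E c = (\<lambda>p f. \<Sum>i\<in>UNIV. c $ i * E i p f)"

definition orthonormal_basis ::
  "'g::{t2_space,second_countable_topology} monoid \<Rightarrow> ('g, 'e::euclidean_space) atlas \<Rightarrow>
   ('g \<Rightarrow> 'g tvec \<Rightarrow> 'g tvec \<Rightarrow> real) \<Rightarrow> (3 \<Rightarrow> 'g vfield) \<Rightarrow> bool" where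
  "orthonormal_basis G \<A> m E \<longleftrightarrow>
     (\<forall>i. E i \<in> lie_algebra G \<A>) \<and>
     (\<forall>i j. lie_inner G m (E i) (E j) = (if i = j then 1 else 0)) \<and>
     (\<forall>X\<in>lie_algebra G \<A>. \<exists>c. X = lincomb E c)"

section \<open>Vector fields along a curve\<close>

text \<open>A vector field along \<open>\<alpha>\<close> is a function \<open>W\<close> on the parameters with \<open>W s\<close> a tangent vector at
  \<open>\<alpha> s\<close>.  Its components \<open>w\<^sub>i\<close> in the frame \<open>E\<close> form a curve in \<open>\<real>\<^sup>3\<close>.\<close>

definition components ::
  "('g \<Rightarrow> 'g tvec \<Rightarrow> 'g tvec \<Rightarrow> real) \<Rightarrow> (3 \<Rightarrow> 'g vfield) \<Rightarrow> (real \<Rightarrow> 'g) \<Rightarrow>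
   (real \<Rightarrow> 'g tvec) \<Rightarrow> real \<Rightarrow> real ^ 3" where
  "components m E \<alpha> W s = (\<chi> i. m (\<alpha> s) (W s) (E i (\<alpha> s)))"

definition dot_along ::
  "('g \<Rightarrow> 'g tvec \<Rightarrow> 'g tvec \<Rightarrow> real) \<Rightarrow> (3 \<Rightarrow> 'g vfield) \<Rightarrow> (real \<Rightarrow> 'g) \<Rightarrow>
   (real \<Rightarrow> 'g tvec) \<Rightarrow> real \<Rightarrow> 'g tvec" where
  "dot_along m E \<alpha> W s =
     lincomb E (\<chi> i. deriv (\<lambda>u. components m E \<alpha> W u $ i) s) (\<alpha> s)"

definition bracket_along ::
  "('g::topological_space, 'e::euclidean_space) atlas \<Rightarrow>
   ('g \<Rightarrow> 'g tvec \<Rightarrow> 'g tvec \<Rightarrow> real) \<Rightarrow> (3 \<Rightarrow> 'g vfield) \<Rightarrow> (real \<Rightarrow> 'g) \<Rightarrow>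
   (real \<Rightarrow> 'g tvec) \<Rightarrow> (real \<Rightarrow> 'g tvec) \<Rightarrow> real \<Rightarrow> 'g tvec" where
  "bracket_along \<A> m E \<alpha> W Z s = (\<lambda>f. \<Sum>i\<in>UNIV. \<Sum>j\<in>UNIV.
     components m E \<alpha> W s $ i * components m E \<alpha> Z s $ j * lie_bracket \<A> (E i) (E j) (\<alpha> s) f)"

text \<open>The covariant derivative along \<open>\<alpha>\<close> induced by \<open>D\<close>, that is
  \<open>\<Sum>\<^sub>j w\<^sub>j' E\<^sub>j + \<Sum>\<^sub>i\<^sub>j t\<^sub>i w\<^sub>j D\<^bsub>E\<^sub>i\<^esub> E\<^sub>j\<close> where \<open>t\<^sub>i\<close> are the components of \<open>\<alpha>'\<close>.  Since
  \<open>D\<^sub>X Y = [X, Y] / 2\<close> on the Lie algebra, the second sum is \<open>[\<alpha>', W] / 2\<close>.\<close>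

definition cov_along ::
  "('g::topological_space, 'e::euclidean_space) atlas \<Rightarrow>
   ('g \<Rightarrow> 'g tvec \<Rightarrow> 'g tvec \<Rightarrow> real) \<Rightarrow> ('g vfield \<Rightarrow> 'g vfield \<Rightarrow> 'g vfield) \<Rightarrow>
   (3 \<Rightarrow> 'g vfield) \<Rightarrow> (real \<Rightarrow> 'g) \<Rightarrow> (real \<Rightarrow> 'g tvec) \<Rightarrow> real \<Rightarrow> 'g tvec" where
  "cov_along \<A> m D E \<alpha> W s = (\<lambda>f. dot_along m E \<alpha> W s f +
     (\<Sum>i\<in>UNIV. \<Sum>j\<in>UNIV.
        components m E \<alpha> (velocity \<A> \<alpha>) s $ i * components m E \<alpha> W s $ j *
        D (E i) (E j) (\<alpha> s) f))"

definition cross_along ::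
  "('g \<Rightarrow> 'g tvec \<Rightarrow> 'g tvec \<Rightarrow> real) \<Rightarrow> (3 \<Rightarrow> 'g vfield) \<Rightarrow> (real \<Rightarrow> 'g) \<Rightarrow>
   (real \<Rightarrow> 'g tvec) \<Rightarrow> (real \<Rightarrow> 'g tvec) \<Rightarrow> real \<Rightarrow> 'g tvec" where
  "cross_along m E \<alpha> W Z s =
     lincomb E (cross3 (components m E \<alpha> W s) (components m E \<alpha> Z s)) (\<alpha> s)"

section \<open>Unit speed curves, Frenet apparatus, slant helices\<close>

definition unit_speed_curve ::
  "('g::topological_space, 'e::euclidean_space) atlas \<Rightarrow>
   ('g \<Rightarrow> 'g tvec \<Rightarrow> 'g tvec \<Rightarrow> real) \<Rightarrow> real set \<Rightarrow> (real \<Rightarrow> 'g) \<Rightarrow> bool" where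
  "unit_speed_curve \<A> m I \<alpha> \<longleftrightarrow> smooth_map std_atlas \<A> I \<alpha> \<and>
     (\<forall>s\<in>I. m (\<alpha> s) (velocity \<A> \<alpha> s) (velocity \<A> \<alpha> s) = 1)"

text \<open>The orientation used for the cross product is the one in which \<open>(E 1, E 2, E 3)\<close> is
  positively oriented.\<close>

definition frenet_apparatus ::
  "('g::topological_space, 'e::euclidean_space) atlas \<Rightarrow>
   ('g \<Rightarrow> 'g tvec \<Rightarrow> 'g tvec \<Rightarrow> real) \<Rightarrow> ('g vfield \<Rightarrow> 'g vfield \<Rightarrow> 'g vfield) \<Rightarrow>
   (3 \<Rightarrow> 'g vfield) \<Rightarrow> real set \<Rightarrow> (real \<Rightarrow> 'g) \<Rightarrow>
   (real \<Rightarrow> 'g tvec) \<Rightarrow> (real \<Rightarrow> 'g tvec) \<Rightarrow> (real \<Rightarrow> 'g tvec) \<Rightarrow>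
   (real \<Rightarrow> real) \<Rightarrow> (real \<Rightarrow> real) \<Rightarrow> bool" where
  "frenet_apparatus \<A> m D E I \<alpha> T N B \<kappa> \<tau> \<longleftrightarrow> (\<forall>s\<in>I.
     T s \<in> tangent_space \<A> (\<alpha> s) \<and> N s \<in> tangent_space \<A> (\<alpha> s) \<and> B s \<in> tangent_space \<A> (\<alpha> s) \<and>
     m (\<alpha> s) (T s) (T s) = 1 \<and> m (\<alpha> s) (N s) (N s) = 1 \<and> m (\<alpha> s) (B s) (B s) = 1 \<and>
     m (\<alpha> s) (T s) (N s) = 0 \<and> m (\<alpha> s) (T s) (B s) = 0 \<and> m (\<alpha> s) (N s) (B s) = 0 \<and>
     T s = velocity \<A> \<alpha> s \<and>
     B s = cross_along m E \<alpha> T N s \<and>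
     \<kappa> s = sqrt (m (\<alpha> s) (dot_along m E \<alpha> T s) (dot_along m E \<alpha> T s)) \<and> \<kappa> s > 0 \<and>
     cov_along \<A> m D E \<alpha> T s = (\<lambda>f. \<kappa> s * N s f) \<and>
     cov_along \<A> m D E \<alpha> N s = (\<lambda>f. - \<kappa> s * T s f + \<tau> s * B s f) \<and>
     cov_along \<A> m D E \<alpha> B s = (\<lambda>f. - \<tau> s * N s f))"

definition group_torsion ::
  "('g::topological_space, 'e::euclidean_space) atlas \<Rightarrow>
   ('g \<Rightarrow> 'g tvec \<Rightarrow> 'g tvec \<Rightarrow> real) \<Rightarrow> (3 \<Rightarrow> 'g vfield) \<Rightarrow> (real \<Rightarrow> 'g) \<Rightarrow>
   (real \<Rightarrow> 'g tvec) \<Rightarrow> (real \<Rightarrow> 'g tvec) \<Rightarrow> (real \<Rightarrow> 'g tvec) \<Rightarrow> real \<Rightarrow> real" where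
  "group_torsion \<A> m E \<alpha> T N B s = 1/2 * m (\<alpha> s) (bracket_along \<A> m E \<alpha> T N s) (B s)"

text \<open>An angle between two vectors lies in \<open>[0, \<pi>]\<close>.\<close>

definition slant_helix ::
  "'g::{t2_space,second_countable_topology} monoid \<Rightarrow> ('g, 'e::euclidean_space) atlas \<Rightarrow>
   ('g \<Rightarrow> 'g tvec \<Rightarrow> 'g tvec \<Rightarrow> real) \<Rightarrow> real set \<Rightarrow> (real \<Rightarrow> 'g) \<Rightarrow> (real \<Rightarrow> 'g tvec) \<Rightarrow>
   bool" where
  "slant_helix G \<A> m I \<alpha> N \<longleftrightarrow> (\<exists>X\<in>lie_algebra G \<A>. lie_inner G m X X = 1 \<and>
     (\<exists>\<theta>\<in>{0..pi}. \<theta> \<noteq> pi / 2 \<and> (\<forall>s\<in>I. m (\<alpha> s) (N s) (X (\<alpha> s)) = cos \<theta>)))"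

end

theory Submission
  imports Defs
begin

text \<open>
  In a left invariant orthonormal frame \<open>E\<close> a vector field along the curve becomes a curve in \<open>\<real>\<^sup>3\<close>, and a
  left invariant field becomes a constant vector.  The theorem then reduces to one on space curves.

  Bi-invariance of the metric makes the structure constants \<open>\<langle>[E\<^sub>i, E\<^sub>j], E\<^sub>k\<rangle>\<close> totally antisymmetric
  (\<open>bracket_frame_skew\<close>, \<open>structure_constant_skew\<close>).  In dimension three they are therefore a multiple
  \<open>c\<close> of the volume form, so that \<open>[X, Y] = c X \<times> Y\<close> on the Lie algebra, and \<open>D\<^sub>X Y = (c / 2) X \<times> Y\<close> by the Koszul
  formula (\<open>bracket_cross3\<close>, \<open>levi_civita_cross3\<close>).  Along the curve this gives \<open>\<tau>\<^sub>G = c / 2\<close>, and the Frenet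
  equations turn into
  \<open>t' = \<kappa> n\<close>, \<open>n' = - \<kappa> t + \<kappa> H b\<close>, \<open>b' = - \<kappa> H n\<close> for the components (\<open>dot_frenet\<close>):
  the curve behaves like a space curve with curvature \<open>\<kappa>\<close> and torsion \<open>\<tau> - \<tau>\<^sub>G\<close>.

  For a unit vector \<open>x\<close> with \<open>n \<bullet> x = cos \<theta>\<close> these equations force \<open>t \<bullet> x = H (b \<bullet> x)\<close>, then
  \<open>H' (b \<bullet> x) = \<kappa> cos \<theta> (1 + H\<^sup>2)\<close>, and \<open>(b \<bullet> x)\<^sup>2 (1 + H\<^sup>2) = sin\<^sup>2 \<theta>\<close>.  The second one
  shows that \<open>H'\<close> and \<open>b \<bullet> x\<close> have no zero, and eliminating \<open>b \<bullet> x\<close> gives the slope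
  \<open>\<sigma>\<^sub>N = \<plusminus> tan \<theta>\<close>.  Conversely, if \<open>\<sigma>\<^sub>N = tan \<theta>\<close>, the vector
  \<open>(sin \<theta> / \<surd>(1 + H\<^sup>2)) (H t + b) + cos \<theta> n\<close> has derivative zero and is the axis
  (\<open>constant_angle_iff_slope\<close>).

  The tangent space is defined by velocities of curves, so its linear structure, the expansion of vectors in
  the frame and the smoothness of the components are derived from charts: chart coordinates identify
  the tangent space with the model space, and frame components are solutions of linear systems with
  smooth coefficients (\<open>tangent_space_eq_chart_vec\<close>, \<open>frame_span\<close>, \<open>frame_components_Ck\<close>).
\<close>

section \<open>Calculus of iterated derivatives\<close>

lemma Ck_on_Suc_lower: "Ck_on (Suc n) S f \<Longrightarrow> Ck_on n S f"
proof (induction n arbitrary: f)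
  case 0
  then have "\<forall>x\<in>S. f differentiable (at x)" by simp
  then show ?case
    by (auto intro!: continuous_at_imp_continuous_on differentiable_imp_continuous_within)
next
  case (Suc n)
  then show ?case by (auto simp del: Ck_on.simps(2) simp add: Ck_on.simps(2)[of "Suc n"] Ck_on.simps(2)[of n S f])
qed

lemma Ck_on_subset: "Ck_on n S f \<Longrightarrow> S' \<subseteq> S \<Longrightarrow> Ck_on n S' f"
  by (induction n arbitrary: f) (auto intro: continuous_on_subset)

lemma Ck_on_cong:
  assumes "open S" "\<And>x. x \<in> S \<Longrightarrow> f x = g x" "Ck_on n S f"
  shows "Ck_on n S g"
  using assms(2,3)
proof (induction n arbitrary: f g)
  case 0
  then show ?case by (simp cong: continuous_on_cong)
next
  case (Suc n)
  have d: "f differentiable (at x)" if "x \<in> S" for x using Suc.prems that by simp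
  have "g differentiable (at x)" if "x \<in> S" for x
    using d[OF that] assms(1) that Suc.prems(1)
    by (meson differentiable_def has_derivative_transform_within_open)
  moreover have "frechet_derivative f (at x) = frechet_derivative g (at x)" if "x \<in> S" for x
    using frechet_derivative_transform_within_open[OF d[OF that] assms(1) that] Suc.prems(1) by blast
  then have "Ck_on n S (\<lambda>x. frechet_derivative g (at x) v)" for v
    using Suc.IH[of "\<lambda>x. frechet_derivative f (at x) v" "\<lambda>x. frechet_derivative g (at x) v"] Suc.prems(2)
    by simp
  ultimately show ?case by simp
qed

text \<open>Smoothness is checked chart by chart, so it has to be a local property.\<close>

lemma Ck_on_local:
  assumes "\<And>x. x \<in> S \<Longrightarrow> \<exists>T. open T \<and> x \<in> T \<and> Ck_on n T f"
  shows "Ck_on n S f"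
  using assms
proof (induction n arbitrary: f)
  case 0
  have "isCont f x" if "x \<in> S" for x
    using 0[OF that] by (auto simp: continuous_on_eq_continuous_at)
  then show ?case by (simp add: continuous_at_imp_continuous_on)
next
  case (Suc n)
  then show ?case by simp meson
qed

text \<open>The form in which the closure properties below are proved: it suffices to name some derivative whose
  directional values are \<open>n\<close> times continuously differentiable.\<close>

lemma Ck_on_SucI:
  assumes "open S" "\<And>x. x \<in> S \<Longrightarrow> (f has_derivative f' x) (at x)" "\<And>v. Ck_on n S (\<lambda>x. f' x v)"
  shows "Ck_on (Suc n) S f"
proof -
  have "f' x v = frechet_derivative f (at x) v" if "x \<in> S" for x v
    using frechet_derivative_at[OF assms(2)[OF that]] by simp
  then show ?thesis
    using Ck_on_cong[OF assms(1) _ assms(3)] assms(2) unfolding Ck_on.simps differentiable_def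
    by (metis (no_types, lifting))
qed

lemma Ck_on_Suc_has_derivative:
  "Ck_on (Suc n) S f \<Longrightarrow> x \<in> S \<Longrightarrow> (f has_derivative frechet_derivative f (at x)) (at x)"
  by (simp add: frechet_derivative_works)

lemma Ck_on_const: "Ck_on n S (\<lambda>x. c)"
  by (induction n arbitrary: c) auto

lemma Ck_on_add:
  assumes "open S" "Ck_on n S f" "Ck_on n S g"
  shows "Ck_on n S (\<lambda>x. f x + g x)"
  using assms(2,3)
proof (induction n arbitrary: f g)
  case (Suc n)
  show ?case
    by (rule Ck_on_SucI[OF assms(1) has_derivative_add])
      (use Suc in \<open>auto simp: frechet_derivative_works\<close>)
qed (auto intro: continuous_intros)

lemma Ck_on_sum:
  assumes "open S" "\<And>i. i \<in> K \<Longrightarrow> Ck_on n S (f i)"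
  shows "Ck_on n S (\<lambda>x. \<Sum>i\<in>K. f i x)"
  using assms(2) by (induction K rule: infinite_finite_induct)
    (auto simp: Ck_on_const intro: Ck_on_add[OF assms(1)])

lemma Ck_on_bounded_linear:
  assumes "open S" "bounded_linear L" "Ck_on n S f"
  shows "Ck_on n S (\<lambda>x. L (f x))"
  using assms(3)
proof (induction n arbitrary: f)
  case 0
  then show ?case
    using assms(2) by (simp add: bounded_linear.continuous_on)
next
  case (Suc n)
  show ?case
    by (rule Ck_on_SucI[OF assms(1) bounded_linear.has_derivative[OF assms(2)]])
      (use Suc in \<open>auto simp: frechet_derivative_works\<close>)
qed

lemma Ck_on_scaleR:
  fixes f :: "'a::euclidean_space \<Rightarrow> real" and g :: "'a \<Rightarrow> 'b::euclidean_space"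
  assumes "open S" "Ck_on n S f" "Ck_on n S g"
  shows "Ck_on n S (\<lambda>x. f x *\<^sub>R g x)"
  using assms(2,3)
proof (induction n arbitrary: f g)
  case (Suc n)
  show ?case
  proof (rule Ck_on_SucI[OF assms(1) has_derivative_scaleR])
    show "Ck_on n S (\<lambda>x. f x *\<^sub>R frechet_derivative g (at x) v
        + frechet_derivative f (at x) v *\<^sub>R g x)" for v
      using Suc by (auto intro!: Ck_on_add[OF assms(1)] Suc.IH simp: Ck_on_Suc_lower simp del: Ck_on.simps)
        (auto)
  qed (use Suc.prems in \<open>auto simp: frechet_derivative_works\<close>)
qed (auto intro: continuous_intros)

lemmas Ck_on_mult = Ck_on_scaleR[where 'b = real, unfolded real_scaleR_def]

lemma Ck_on_prod:
  assumes "open S" "\<And>i. i \<in> K \<Longrightarrow> Ck_on n S (f i :: _ \<Rightarrow> real)"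
  shows "Ck_on n S (\<lambda>x. \<Prod>i\<in>K. f i x)"
  using assms(2) by (induction K rule: infinite_finite_induct)
    (auto simp: Ck_on_const intro: Ck_on_mult[OF assms(1)])

text \<open>The derivative \<open>- f' / f\<^sup>2\<close> contains only the inverse itself, so the induction closes; the same
  happens for the square root, whose derivative contains the inverse of the root.\<close>

lemma Ck_on_inverse:
  fixes f :: "'a::euclidean_space \<Rightarrow> real"
  assumes "open S" "Ck_on n S f" "\<And>x. x \<in> S \<Longrightarrow> f x \<noteq> 0"
  shows "Ck_on n S (\<lambda>x. inverse (f x))"
  using assms(2)
proof (induction n)
  case 0
  then show ?case using assms(3) by (auto intro: continuous_intros)
next
  case (Suc n)
  note inv = Suc.IH[OF Ck_on_Suc_lower[OF Suc.prems]]
  have "Ck_on n S (\<lambda>x. (-1) * (inverse (f x) * frechet_derivative f (at x) v * inverse (f x)))" for v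
    using Suc.prems
    by (intro Ck_on_mult assms inv) (auto simp: Ck_on_const)
  then show ?case
    using Suc.prems assms(3)
    by (intro Ck_on_SucI[OF assms(1) Deriv.has_derivative_inverse]) (auto simp: frechet_derivative_works)
qed

lemma Ck_on_sqrt:
  fixes f :: "'a::euclidean_space \<Rightarrow> real"
  assumes "open S" "Ck_on n S f" "\<And>x. x \<in> S \<Longrightarrow> f x > 0"
  shows "Ck_on n S (\<lambda>x. sqrt (f x))"
  using assms(2)
proof (induction n)
  case 0
  then show ?case by (auto intro: continuous_intros)
next
  case (Suc n)
  have "Ck_on n S (\<lambda>x. inverse (sqrt (f x)))"
    using assms(3) by (intro Ck_on_inverse assms(1) Suc.IH Ck_on_Suc_lower[OF Suc.prems]) force
  then have "Ck_on n S (\<lambda>x. frechet_derivative f (at x) v * (inverse (sqrt (f x)) * (1/2)))" for v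
    using Suc.prems by (intro Ck_on_mult assms(1) Ck_on_const) auto
  moreover have "((\<lambda>x. sqrt (f x)) has_derivative
      (\<lambda>v. frechet_derivative f (at x) v * (inverse (sqrt (f x)) * (1/2)))) (at x)" if "x \<in> S" for x
    using has_derivative_real_sqrt[OF assms(3)[OF that] Ck_on_Suc_has_derivative[OF Suc.prems that]]
    by (simp add: field_simps)
  ultimately show ?case by (intro Ck_on_SucI[OF assms(1)])
qed

lemma Ck_on_real_deriv:
  fixes f :: "real \<Rightarrow> real"
  assumes "open S" "Ck_on (Suc n) S f"
  shows "x \<in> S \<Longrightarrow> (f has_real_derivative deriv f x) (at x)" and "Ck_on n S (deriv f)"
proof -
  show D: "(f has_real_derivative deriv f x) (at x)" if "x \<in> S" for x
    using assms(2) that DERIV_deriv_iff_real_differentiable by auto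
  have "frechet_derivative f (at x) 1 = deriv f x" if "x \<in> S" for x
    using fun_cong[OF frechet_derivative_at[OF D[OF that, unfolded has_field_derivative_def]], of 1] by simp
  then show "Ck_on n S (deriv f)"
    by (rule Ck_on_cong[OF assms(1)]) (use assms(2) in auto)
qed

lemma Ck_on_affine: "bounded_linear L \<Longrightarrow> open S \<Longrightarrow> Ck_on n S (\<lambda>x. c + L x)"
proof (cases n)
  case (Suc k)
  assume L: "bounded_linear L" "open S"
  show ?thesis unfolding Suc
    by (rule Ck_on_SucI[OF L(2), where f' = "\<lambda>_. L"])
      (auto intro!: derivative_eq_intros bounded_linear_imp_has_derivative L Ck_on_const)
qed (auto intro: continuous_intros simp: linear_continuous_on)

text \<open>In the chain rule the direction \<open>g'(x) v\<close> varies with \<open>x\<close>, whereas the definition differentiates in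
  fixed directions.  Expanding the direction in the standard basis reduces the claim to products and to
  the induction hypothesis.\<close>

lemma Ck_on_compose:
  fixes f :: "'b::euclidean_space \<Rightarrow> 'c::euclidean_space" and g :: "'a::euclidean_space \<Rightarrow> 'b"
  assumes "open S" "open T" "\<And>x. x \<in> S \<Longrightarrow> g x \<in> T" "Ck_on n T f" "Ck_on n S g"
  shows "Ck_on n S (\<lambda>x. f (g x))"
  using assms(4,5)
proof (induction n arbitrary: f)
  case 0
  then show ?case
    using assms(3) continuous_on_compose2[of T f S g] by auto
next
  case (Suc n)
  have g: "Ck_on n S g" using Suc.prems Ck_on_Suc_lower by blast
  have df: "(f has_derivative frechet_derivative f (at (g x))) (at (g x))" if "x \<in> S" for x
    using Suc.prems assms(3) that by (auto simp: frechet_derivative_works)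
  have "((\<lambda>x. f (g x)) has_derivative
        (\<lambda>v. frechet_derivative f (at (g x)) (frechet_derivative g (at x) v))) (at x)"
    if "x \<in> S" for x
    using diff_chain_at[OF Ck_on_Suc_has_derivative[OF Suc.prems(2) that] df[OF that]] by (simp add: o_def)
  moreover have "frechet_derivative f (at (g x)) (frechet_derivative g (at x) v)
      = (\<Sum>b\<in>Basis. (frechet_derivative g (at x) v \<bullet> b) *\<^sub>R frechet_derivative f (at (g x)) b)"
    if "x \<in> S" for x v
  proof -
    have l: "linear (frechet_derivative f (at (g x)))"
      using df[OF that] has_derivative_linear by blast
    show ?thesis
      by (subst euclidean_representation[symmetric]) (simp add: linear_sum[OF l] linear_scale[OF l])
  qed
  ultimately have "((\<lambda>x. f (g x)) has_derivative
        (\<lambda>v. \<Sum>b\<in>Basis. (frechet_derivative g (at x) v \<bullet> b) *\<^sub>R frechet_derivative f (at (g x)) b)) (at x)"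
    if "x \<in> S" for x
    using that by simp
  moreover have "Ck_on n S (\<lambda>x. \<Sum>b\<in>Basis. (frechet_derivative g (at x) v \<bullet> b) *\<^sub>R frechet_derivative f (at (g x)) b)" for v
    using Suc.prems
    by (intro Ck_on_sum Ck_on_scaleR assms(1) Ck_on_bounded_linear[OF assms(1) bounded_linear_inner_left]
        Suc.IH g) auto
  ultimately show ?case
    by (rule Ck_on_SucI[OF assms(1)])
qed

lemma Ck_on_Pair:
  assumes "open S" "Ck_on n S f" "Ck_on n S g"
  shows "Ck_on n S (\<lambda>x. (f x, g x))"
proof -
  have "Ck_on n S (\<lambda>x. (f x, 0) + (0, g x))"
    by (intro Ck_on_add assms Ck_on_bounded_linear[OF assms(1), where L = "\<lambda>x. (x, 0)"]
       Ck_on_bounded_linear[OF assms(1), where L = "\<lambda>x. (0, x)"] bounded_linear_Pair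
       bounded_linear_ident bounded_linear_zero)
  then show ?thesis by simp
qed

lemma Ck_on_det:
  fixes M :: "'a::euclidean_space \<Rightarrow> real ^ 'n ^ 'n"
  assumes "open S" "\<And>i j. Ck_on n S (\<lambda>x. M x $ i $ j)"
  shows "Ck_on n S (\<lambda>x. det (M x))"
  unfolding det_def by (intro Ck_on_sum Ck_on_mult Ck_on_prod assms Ck_on_const)

text \<open>By Cramer's rule the solution is a quotient of polynomials in the coefficients.\<close>

lemma Ck_on_linear_system:
  fixes M :: "'a::euclidean_space \<Rightarrow> real ^ 'n ^ 'n" and c b :: "'a \<Rightarrow> real ^ 'n"
  assumes "open S" "\<And>i j. Ck_on n S (\<lambda>x. M x $ i $ j)" "\<And>i. Ck_on n S (\<lambda>x. b x $ i)"
    and "\<And>x. x \<in> S \<Longrightarrow> det (M x) \<noteq> 0" "\<And>x. x \<in> S \<Longrightarrow> M x *v c x = b x"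
  shows "Ck_on n S (\<lambda>x. c x $ k)"
proof -
  let ?R = "\<lambda>x. (\<chi> i j. if j = k then b x $ i else M x $ i $ j) :: real ^ 'n ^ 'n"
  have "Ck_on n S (\<lambda>x. det (?R x))"
  proof (rule Ck_on_det[OF assms(1)])
    show "Ck_on n S (\<lambda>x. ?R x $ i $ j)" for i j
      using assms(2)[of i j] assms(3)[of i] by (cases "j = k") (simp_all only: vec_lambda_beta if_True if_False simp_thms)
  qed
  then have "Ck_on n S (\<lambda>x. det (?R x) * inverse (det (M x)))"
    by (rule Ck_on_mult[OF assms(1) _ Ck_on_inverse[OF assms(1) Ck_on_det[OF assms(1,2)] assms(4)]])
  moreover have "det (?R x) * inverse (det (M x)) = c x $ k" if "x \<in> S" for x
  proof -
    have "c x = (\<chi> k. det (\<chi> i j. if j = k then b x $ i else M x $ i $ j) / det (M x))"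
      by (rule cramer[OF assms(4)[OF that], THEN iffD1, OF assms(5)[OF that]])
    from arg_cong[OF this, of "\<lambda>v. v $ k"] show ?thesis
      unfolding vec_lambda_beta divide_inverse by (rule sym)
  qed
  ultimately show ?thesis
    by (rule Ck_on_cong[OF assms(1), rotated])
qed

text \<open>Two applications of the mean value theorem.  The second difference on the left is symmetric in the two
  variables, which is why the mixed partial derivatives agree.\<close>

lemma second_difference_mean_value:
  fixes F :: "real \<Rightarrow> real \<Rightarrow> real"
  assumes "h > 0"
    and "\<And>s t. 0 \<le> s \<Longrightarrow> s \<le> h \<Longrightarrow> 0 \<le> t \<Longrightarrow> t \<le> h \<Longrightarrow>
           ((\<lambda>s. F s t) has_real_derivative P s t) (at s)"
    and "\<And>s t. 0 \<le> s \<Longrightarrow> s \<le> h \<Longrightarrow> 0 \<le> t \<Longrightarrow> t \<le> h \<Longrightarrow>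
           ((\<lambda>t. P s t) has_real_derivative Q s t) (at t)"
  shows "\<exists>s t. 0 < s \<and> s < h \<and> 0 < t \<and> t < h \<and> F h h - F h 0 - F 0 h + F 0 0 = h * h * Q s t"
proof -
  have "((\<lambda>s. F s h - F s 0) has_real_derivative P s h - P s 0) (at s)" if "0 \<le> s" "s \<le> h" for s
    using assms that by (intro derivative_intros) auto
  then obtain s where s: "0 < s" "s < h" "(F h h - F h 0) - (F 0 h - F 0 0) = (h - 0) * (P s h - P s 0)"
    using MVT2[of 0 h "\<lambda>s. F s h - F s 0" "\<lambda>s. P s h - P s 0"] assms(1) by auto
  obtain t where "0 < t" "t < h" "P s h - P s 0 = (h - 0) * Q s t"
    using MVT2[of 0 h "P s" "Q s"] assms s by auto
  then show ?thesis using s by (intro exI[of _ s] exI[of _ t]) (simp add: algebra_simps)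
qed

lemma frechet_partial_derivatives:
  fixes f :: "real \<times> real \<Rightarrow> real"
  assumes "f differentiable (at (s, t))"
  shows "((\<lambda>s. f (s, t)) has_real_derivative frechet_derivative f (at (s, t)) (1, 0)) (at s)"
    and "((\<lambda>t. f (s, t)) has_real_derivative frechet_derivative f (at (s, t)) (0, 1)) (at t)"
proof -
  let ?D = "frechet_derivative f (at (s, t))"
  have f: "(f has_derivative ?D) (at (s, t))" using assms by (simp add: frechet_derivative_works)
  have l: "linear ?D" using f has_derivative_linear by blast
  have "((\<lambda>s. f (s, t)) has_derivative (\<lambda>h. ?D (h, 0))) (at s)"
    by (rule has_derivative_compose[OF has_derivative_Pair[OF has_derivative_ident has_derivative_const] f])
  moreover have "(\<lambda>h. ?D (h, 0)) = (*) (?D (1, 0))"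
  proof
    show "?D (h, 0) = ?D (1, 0) * h" for h
      using linear_scale[OF l, of h "(1, 0)"] by simp
  qed
  ultimately show "((\<lambda>s. f (s, t)) has_real_derivative ?D (1, 0)) (at s)"
    by (simp only: has_field_derivative_def)
  have "((\<lambda>t. f (s, t)) has_derivative (\<lambda>h. ?D (0, h))) (at t)"
    by (rule has_derivative_compose[OF has_derivative_Pair[OF has_derivative_const has_derivative_ident] f])
  moreover have "(\<lambda>h. ?D (0, h)) = (*) (?D (0, 1))"
  proof
    show "?D (0, h) = ?D (0, 1) * h" for h
      using linear_scale[OF l, of h "(0, 1)"] by simp
  qed
  ultimately show "((\<lambda>t. f (s, t)) has_real_derivative ?D (0, 1)) (at t)"
    by (simp only: has_field_derivative_def)
qed

text \<open>By the previous lemma both mixed derivatives take a common value at points arbitrarily close to the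
  origin, and both are continuous there.\<close>

lemma mixed_partials_commute:
  fixes F :: "real \<times> real \<Rightarrow> real"
  assumes "open S" "(0, 0) \<in> S" "Ck_on 2 S F"
  defines "P1 \<equiv> \<lambda>x. frechet_derivative F (at x) (1, 0)" and "P2 \<equiv> \<lambda>x. frechet_derivative F (at x) (0, 1)"
  shows "deriv (\<lambda>t. P1 (0, t)) 0 = deriv (\<lambda>s. P2 (s, 0)) 0"
proof -
  let ?P12 = "\<lambda>x. frechet_derivative P1 (at x) (0, 1)" and ?P21 = "\<lambda>x. frechet_derivative P2 (at x) (1, 0)"
  have C: "Ck_on (Suc (Suc 0)) S F" using assms(3) by (simp add: numeral_2_eq_2)
  have dF: "F differentiable (at x)" and dP: "P1 differentiable (at x)" "P2 differentiable (at x)" if "x \<in> S" for x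
    using C that by (auto simp: P1_def P2_def)
  have dirF: "((\<lambda>s. F (s, t)) has_real_derivative P1 (s, t)) (at s)"
      "((\<lambda>t. F (s, t)) has_real_derivative P2 (s, t)) (at t)" if "(s, t) \<in> S" for s t
    unfolding P1_def P2_def using frechet_partial_derivatives[OF dF[OF that]] .
  have dirP: "((\<lambda>t. P1 (s, t)) has_real_derivative ?P12 (s, t)) (at t)"
      "((\<lambda>s. P2 (s, t)) has_real_derivative ?P21 (s, t)) (at s)" if "(s, t) \<in> S" for s t
    using frechet_partial_derivatives(2)[OF dP(1)[OF that]] frechet_partial_derivatives(1)[OF dP(2)[OF that]] .
  have "continuous_on S ?P12" "continuous_on S ?P21" using C by (auto simp: P1_def P2_def)
  then have cont: "isCont ?P12 (0,0)" "isCont ?P21 (0,0)"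
    using assms(1,2) by (auto simp: continuous_on_eq_continuous_at)
  have "?P12 (0, 0) = ?P21 (0, 0)"
  proof (rule ccontr)
    assume "?P12 (0, 0) \<noteq> ?P21 (0, 0)"
    then have e: "dist (?P12 (0, 0)) (?P21 (0, 0)) / 2 > 0" (is "?e > 0") by simp
    obtain d1 where d1: "d1 > 0" "\<And>x. dist x (0,0) < d1 \<Longrightarrow> dist (?P12 x) (?P12 (0, 0)) < ?e"
      using cont(1) e unfolding continuous_at_eps_delta by metis
    obtain d2 where d2: "d2 > 0" "\<And>x. dist x (0,0) < d2 \<Longrightarrow> dist (?P21 x) (?P21 (0, 0)) < ?e"
      using cont(2) e unfolding continuous_at_eps_delta by metis
    obtain d3 where d3: "d3 > 0" "\<And>x. dist x (0,0) < d3 \<Longrightarrow> x \<in> S"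
      using assms(1,2) unfolding open_dist by metis
    define h where "h = min d1 (min d2 d3) / 3"
    have h: "h > 0" "3 * h \<le> d1" "3 * h \<le> d2" "3 * h \<le> d3" using d1 d2 d3 by (auto simp: h_def)
    have near: "dist (s, t) (0, 0) < 3 * h" if "0 \<le> s" "s \<le> h" "0 \<le> t" "t \<le> h" for s t
    proof -
      have "norm (s, t) \<le> norm s + norm t" by (rule norm_Pair_le)
      then show ?thesis using that h by (simp add: dist_norm)
    qed
    have inS: "(s, t) \<in> S" if "0 \<le> s" "s \<le> h" "0 \<le> t" "t \<le> h" for s t
      using near[OF that] d3(2) h by force
    obtain s t where st: "0 < s" "s < h" "0 < t" "t < h"
        "F (h, h) - F (h, 0) - F (0, h) + F (0, 0) = h * h * ?P12 (s, t)"
      using second_difference_mean_value[of h "\<lambda>s t. F (s, t)" "\<lambda>s t. P1 (s, t)" "\<lambda>s t. ?P12 (s, t)",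
          OF h(1) dirF(1)[OF inS] dirP(1)[OF inS]] by blast
    obtain t' s' where st': "0 < t'" "t' < h" "0 < s'" "s' < h"
        "F (h, h) - F (0, h) - F (h, 0) + F (0, 0) = h * h * ?P21 (s', t')"
      using second_difference_mean_value[of h "\<lambda>t s. F (s, t)" "\<lambda>t s. P2 (s, t)" "\<lambda>t s. ?P21 (s, t)",
          OF h(1) dirF(2)[OF inS] dirP(2)[OF inS]] by blast
    have "h * h * ?P12 (s, t) = h * h * ?P21 (s', t')" using st(5) st'(5) by linarith
    then have "?P12 (s, t) = ?P21 (s', t')" using h(1) by simp
    moreover have "dist (?P12 (s, t)) (?P12 (0, 0)) < ?e"
      using d1(2)[of "(s, t)"] near[of s t] st h by simp
    moreover have "dist (?P21 (s', t')) (?P21 (0, 0)) < ?e"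
      using d2(2)[of "(s', t')"] near[of s' t'] st' h by simp
    ultimately show False by (simp add: dist_real_def abs_if split: if_splits)
  qed
  moreover have "deriv (\<lambda>t. P1 (0, t)) 0 = ?P12 (0, 0)" "deriv (\<lambda>s. P2 (s, 0)) 0 = ?P21 (0, 0)"
    using frechet_partial_derivatives dP assms(2) by (auto intro!: DERIV_imp_deriv)
  ultimately show ?thesis by simp
qed

section \<open>Smooth maps between manifolds\<close>

text \<open>The topological half of being an atlas.  Composition and pairing of smooth maps use only this half,
  and unlike compatibility of the charts it is immediate for the product of two atlases.\<close>

definition chart_cover :: "('p::topological_space, 'e::euclidean_space) atlas \<Rightarrow> bool" where
  "chart_cover \<A> \<longleftrightarrow>
     (\<forall>(U, \<phi>)\<in>\<A>. open U \<and> open (\<phi> ` U) \<and> (\<exists>\<psi>. homeomorphism U (\<phi> ` U) \<phi> \<psi>)) \<and>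
     (\<forall>p. \<exists>(U, \<phi>)\<in>\<A>. p \<in> U)"

lemma chart_cover_smooth_atlas: "smooth_atlas \<A> \<Longrightarrow> chart_cover \<A>"
  unfolding chart_cover_def
proof (intro conjI allI)
  assume *: "smooth_atlas \<A>"
  then show "\<forall>(U, \<phi>)\<in>\<A>. open U \<and> open (\<phi> ` U) \<and> (\<exists>\<psi>. homeomorphism U (\<phi> ` U) \<phi> \<psi>)"
    unfolding smooth_atlas_def by (elim conjE)
  have "p \<in> (\<Union>(U, \<phi>)\<in>\<A>. U)" for p using * by (simp only: smooth_atlas_def UNIV_I)
  then show "\<exists>(U, \<phi>)\<in>\<A>. p \<in> U" for p by blast
qed

lemma chart_cover_std: "chart_cover std_atlas"
  unfolding chart_cover_def std_atlas_def by (auto intro!: exI[of _ id] simp: homeomorphism_def)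

lemma chart_at:
  assumes "chart_cover \<A>" obtains U \<phi> where "(U, \<phi>) \<in> \<A>" "p \<in> U"
proof -
  have "\<exists>(U, \<phi>)\<in>\<A>. p \<in> U" using assms unfolding chart_cover_def by simp
  then show ?thesis using that by auto
qed

lemma chart_cover_prod:
  assumes "chart_cover \<A>" "chart_cover \<B>"
  shows "chart_cover (prod_atlas \<A> \<B>)"
  unfolding chart_cover_def
proof (intro conjI ballI allI)
  fix x assume "x \<in> prod_atlas \<A> \<B>"
  then obtain U \<phi> V \<psi> where x: "x = (U \<times> V, map_prod \<phi> \<psi>)" "(U, \<phi>) \<in> \<A>" "(V, \<psi>) \<in> \<B>"
    by (auto simp: prod_atlas_def)
  obtain f g where fg: "homeomorphism U (\<phi> ` U) \<phi> f" "homeomorphism V (\<psi> ` V) \<psi> g"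
    "open U" "open V" "open (\<phi> ` U)" "open (\<psi> ` V)"
    using assms x unfolding chart_cover_def by fast
  have im: "map_prod \<phi> \<psi> ` (U \<times> V) = \<phi> ` U \<times> \<psi> ` V" by force
  have "homeomorphism (U \<times> V) (\<phi> ` U \<times> \<psi> ` V) (map_prod \<phi> \<psi>) (map_prod f g)"
  proof (rule homeomorphismI)
    have "continuous_on (U \<times> V) (\<lambda>p. \<phi> (fst p))" "continuous_on (U \<times> V) (\<lambda>p. \<psi> (snd p))"
      using fg by (auto simp: homeomorphism_def intro!: continuous_on_compose2[of U \<phi>]
        continuous_on_compose2[of V \<psi>] continuous_intros)
    then show "continuous_on (U \<times> V) (map_prod \<phi> \<psi>)"
      unfolding map_prod_def case_prod_beta by (rule continuous_on_Pair)
    have "continuous_on (\<phi> ` U \<times> \<psi> ` V) (\<lambda>p. f (fst p))" "continuous_on (\<phi> ` U \<times> \<psi> ` V) (\<lambda>p. g (snd p))"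
      using fg by (auto simp: homeomorphism_def intro!: continuous_on_compose2[of "\<phi> ` U" f]
        continuous_on_compose2[of "\<psi> ` V" g] continuous_intros)
    then show "continuous_on (\<phi> ` U \<times> \<psi> ` V) (map_prod f g)"
      unfolding map_prod_def case_prod_beta by (rule continuous_on_Pair)
  qed (use homeomorphism_apply1[OF fg(1)] homeomorphism_apply1[OF fg(2)] in auto)
  then show "case x of (U, \<phi>) \<Rightarrow> open U \<and> open (\<phi> ` U) \<and> (\<exists>\<psi>. homeomorphism U (\<phi> ` U) \<phi> \<psi>)"
    using fg by (auto simp: x im open_Times)
next
  fix p :: "'a \<times> 'c"
  obtain U \<phi> V \<psi> where "(U, \<phi>) \<in> \<A>" "fst p \<in> U" "(V, \<psi>) \<in> \<B>" "snd p \<in> V"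
    using chart_at[OF assms(1)] chart_at[OF assms(2)] by metis
  then have *: "(U \<times> V, map_prod \<phi> \<psi>) \<in> prod_atlas \<A> \<B>" "p \<in> U \<times> V"
    by (auto simp: prod_atlas_def mem_Times_iff)
  show "\<exists>(U, \<phi>)\<in>prod_atlas \<A> \<B>. p \<in> U"
    by (rule bexI[OF _ *(1)], rule case_prodI, rule *(2))
qed

text \<open>This identity makes smooth maps out of \<open>\<real> \<times> \<real>\<close>, with the product atlas, smooth in the usual sense.\<close>

lemma prod_atlas_std: "prod_atlas std_atlas std_atlas = std_atlas"
  by (auto simp: prod_atlas_def std_atlas_def map_prod.identity)

context
  fixes \<A> :: "('p::topological_space, 'e::euclidean_space) atlas" and U \<phi>
  assumes cover: "chart_cover \<A>" and chart: "(U, \<phi>) \<in> \<A>"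
begin

lemma chart_open: "open U" "open (\<phi> ` U)"
  using cover chart unfolding chart_cover_def by auto

lemma chart_homeomorphism: "homeomorphism U (\<phi> ` U) \<phi> (inv_into U \<phi>)"
proof -
  obtain \<psi> where h: "homeomorphism U (\<phi> ` U) \<phi> \<psi>"
    using cover chart unfolding chart_cover_def by auto
  then have "inj_on \<phi> U" by (metis homeomorphism_apply1 inj_onI)
  then have "inv_into U \<phi> y = \<psi> y" if "y \<in> \<phi> ` U" for y
    using that h by (auto simp: homeomorphism_def)
  then show ?thesis using h by (simp add: homeomorphism_def cong: continuous_on_cong image_cong)
qed

lemma chart_inv [simp]: "p \<in> U \<Longrightarrow> inv_into U \<phi> (\<phi> p) = p"
  using chart_homeomorphism by (simp add: homeomorphism_def)

lemma chart_open_image: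
  assumes "open S" "S \<subseteq> U" shows "open (\<phi> ` S)"
proof -
  have "openin (top_of_set (\<phi> ` U)) (\<phi> ` S)"
    using homeomorphism_imp_open_map[OF chart_homeomorphism] assms chart_open
    by (simp add: openin_open_eq)
  then show ?thesis using chart_open openin_open_trans by blast
qed

end

lemma smooth_on_compose:
  fixes f :: "'b::euclidean_space \<Rightarrow> 'c::euclidean_space" and g :: "'a::euclidean_space \<Rightarrow> 'b"
  assumes "open S" "open T" "\<And>x. x \<in> S \<Longrightarrow> g x \<in> T" "smooth_on T f" "smooth_on S g"
  shows "smooth_on S (\<lambda>x. f (g x))"
  using assms Ck_on_compose unfolding smooth_on_def by blast

lemma smooth_on_cong:
  assumes "open S" "\<And>x. x \<in> S \<Longrightarrow> f x = g x" "smooth_on S f" shows "smooth_on S g"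
  using assms Ck_on_cong unfolding smooth_on_def by blast

lemma smooth_on_subset: "smooth_on S f \<Longrightarrow> S' \<subseteq> S \<Longrightarrow> smooth_on S' f"
  using Ck_on_subset unfolding smooth_on_def by blast

lemma smooth_on_local:
  assumes "\<And>x. x \<in> S \<Longrightarrow> \<exists>T. open T \<and> x \<in> T \<and> smooth_on T f" shows "smooth_on S f"
  unfolding smooth_on_def using assms Ck_on_local unfolding smooth_on_def by metis

lemma smooth_on_bounded_linear: "bounded_linear L \<Longrightarrow> open S \<Longrightarrow> smooth_on S L"
  using Ck_on_affine[of L S _ 0] unfolding smooth_on_def by simp

lemma smooth_on_continuous: "smooth_on S f \<Longrightarrow> continuous_on S f"
  unfolding smooth_on_def by (metis Ck_on.simps(1))

lemma open_preimage: "open S \<Longrightarrow> continuous_on S f \<Longrightarrow> open V \<Longrightarrow> open (S \<inter> f -` V)"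
  using continuous_on_open_vimage[of S f] by (metis Int_commute)

lemma smooth_map_open: "smooth_map \<A> \<B> S f \<Longrightarrow> open S"
  and smooth_map_continuous: "smooth_map \<A> \<B> S f \<Longrightarrow> continuous_on S f"
  and smooth_map_charts: "smooth_map \<A> \<B> S f \<Longrightarrow> (U, \<phi>) \<in> \<A> \<Longrightarrow> (V, \<psi>) \<in> \<B> \<Longrightarrow>
        smooth_on (\<phi> ` (S \<inter> U \<inter> f -` V)) (\<psi> \<circ> f \<circ> inv_into U \<phi>)"
  unfolding smooth_map_def by auto

lemma smooth_mapI:
  assumes "open S" "continuous_on S f"
    and "\<And>U \<phi> V \<psi>. (U, \<phi>) \<in> \<A> \<Longrightarrow> (V, \<psi>) \<in> \<B> \<Longrightarrow> 
        smooth_on (\<phi> ` (S \<inter> U \<inter> f -` V)) (\<lambda>x. \<psi> (f (inv_into U \<phi> x)))"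
  shows "smooth_map \<A> \<B> S f"
  unfolding smooth_map_def using assms by (auto simp: o_def)

lemma inv_into_UNIV_id: "inv_into UNIV id = id"
  by (rule ext) (metis id_apply inv_id)

lemma smooth_map_std_iff: "smooth_map std_atlas std_atlas S f \<longleftrightarrow> open S \<and> smooth_on S f"
  unfolding smooth_map_def std_atlas_def by (auto simp: inv_into_UNIV_id smooth_on_continuous)

lemma smooth_map_subset:
  assumes "smooth_map \<A> \<B> S f" "S' \<subseteq> S" "open S'" shows "smooth_map \<A> \<B> S' f"
proof (rule smooth_mapI)
  show "continuous_on S' f" using assms smooth_map_continuous continuous_on_subset by blast
  fix U \<phi> V \<psi> assume "(U, \<phi>) \<in> \<A>" "(V, \<psi>) \<in> \<B>"
  from smooth_map_charts[OF assms(1) this]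
  show "smooth_on (\<phi> ` (S' \<inter> U \<inter> f -` V)) (\<lambda>x. \<psi> (f (inv_into U \<phi> x)))"
    unfolding o_def by (rule smooth_on_subset) (use assms in auto)
qed (rule assms)

text \<open>Near a given point the map read in charts factors through one chart of the middle manifold.\<close>

lemma smooth_map_compose:
  assumes A: "chart_cover \<A>" and B: "chart_cover \<B>" and C: "chart_cover \<C>"
    and f: "smooth_map \<A> \<B> S f" and g: "smooth_map \<B> \<C> T g"
  shows "smooth_map \<A> \<C> (S \<inter> f -` T) (\<lambda>x. g (f x))"
proof -
  note op = smooth_map_open[OF f] smooth_map_open[OF g]
  note co = smooth_map_continuous[OF f] smooth_map_continuous[OF g]
  have cf: "continuous_on (S \<inter> f -` T) f" using co(1) by (rule continuous_on_subset) auto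
  have cgf: "continuous_on (S \<inter> f -` T) (\<lambda>x. g (f x))"
    by (rule continuous_on_compose2[OF co(2) cf]) auto
  have o: "open (S \<inter> f -` T)" using op co open_preimage by blast
  show ?thesis
  proof (rule smooth_mapI[OF o cgf], rule smooth_on_local)
    fix U \<phi> W \<eta> x
    assume U: "(U, \<phi>) \<in> \<A>" and W: "(W, \<eta>) \<in> \<C>"
      and x: "x \<in> \<phi> ` (S \<inter> f -` T \<inter> U \<inter> (\<lambda>x. g (f x)) -` W)"
    then obtain u where u: "x = \<phi> u" "u \<in> S" "f u \<in> T" "u \<in> U" "g (f u) \<in> W" by auto
    obtain V \<psi> where V: "(V, \<psi>) \<in> \<B>" "f u \<in> V" using chart_at[OF B] by blast
    define R where "R = (S \<inter> f -` T \<inter> (\<lambda>x. g (f x)) -` W) \<inter> (S \<inter> f -` V) \<inter> U"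
    have "open R" unfolding R_def
      using open_preimage[OF o cgf chart_open(1)[OF C W]] open_preimage[OF op(1) co(1) chart_open(1)[OF B V(1)]]
        chart_open(1)[OF A U] by auto
    then have oR: "open (\<phi> ` R)" using chart_open_image[OF A U] by (auto simp: R_def)
    have oT: "open (\<psi> ` (T \<inter> V \<inter> g -` W))"
    proof (rule chart_open_image[OF B V(1)])
      have "open ((T \<inter> g -` W) \<inter> V)"
        using open_preimage[OF op(2) co(2) chart_open(1)[OF C W]] chart_open(1)[OF B V(1)] by auto
      then show "open (T \<inter> V \<inter> g -` W)" by (simp add: Int_ac)
    qed auto
    have sf: "smooth_on (\<phi> ` R) (\<psi> \<circ> f \<circ> inv_into U \<phi>)"
      by (rule smooth_on_subset[OF smooth_map_charts[OF f U V(1)]]) (auto simp: R_def)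
    have sgf: "smooth_on (\<phi> ` R) (\<lambda>x. (\<eta> \<circ> g \<circ> inv_into V \<psi>) ((\<psi> \<circ> f \<circ> inv_into U \<phi>) x))"
      by (rule smooth_on_compose[OF oR oT _ smooth_map_charts[OF g V(1) W] sf])
        (auto simp: R_def chart_inv[OF A U] chart_inv[OF B V(1)])
    have "smooth_on (\<phi> ` R) (\<lambda>x. \<eta> (g (f (inv_into U \<phi> x))))"
      by (rule smooth_on_cong[OF oR _ sgf]) (auto simp: R_def chart_inv[OF A U] chart_inv[OF B V(1)])
    moreover have "x \<in> \<phi> ` R" using u V by (auto simp: R_def)
    ultimately show "\<exists>T. open T \<and> x \<in> T \<and> smooth_on T (\<lambda>x. \<eta> (g (f (inv_into U \<phi> x))))"
      using oR by blast
  qed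
qed

lemma smooth_map_Pair:
  assumes A: "chart_cover \<A>" and B: "chart_cover \<B>" and C: "chart_cover \<C>"
    and f: "smooth_map \<A> \<B> S f" and g: "smooth_map \<A> \<C> S g"
  shows "smooth_map \<A> (prod_atlas \<B> \<C>) S (\<lambda>x. (f x, g x))"
proof (rule smooth_mapI)
  note op = smooth_map_open[OF f]
  note co = smooth_map_continuous[OF f] smooth_map_continuous[OF g]
  show "open S" by (rule op)
  show "continuous_on S (\<lambda>x. (f x, g x))" using co by (rule continuous_on_Pair)
  fix U \<phi> VW \<omega> assume U: "(U, \<phi>) \<in> \<A>" and "(VW, \<omega>) \<in> prod_atlas \<B> \<C>"
  then obtain V \<psi> W \<eta> where VW: "VW = V \<times> W" "\<omega> = map_prod \<psi> \<eta>" "(V, \<psi>) \<in> \<B>" "(W, \<eta>) \<in> \<C>"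
    by (auto simp: prod_atlas_def)
  let ?R = "(S \<inter> f -` V) \<inter> (S \<inter> g -` W) \<inter> U"
  have R: "S \<inter> U \<inter> (\<lambda>x. (f x, g x)) -` (V \<times> W) = ?R" by auto
  have "open ?R"
    using open_preimage[OF op co(1) chart_open(1)[OF B VW(3)]] open_preimage[OF op co(2) chart_open(1)[OF C VW(4)]]
      chart_open(1)[OF A U] by auto
  then have oR: "open (\<phi> ` ?R)" using chart_open_image[OF A U] by auto
  have 1: "smooth_on (\<phi> ` ?R) (\<psi> \<circ> f \<circ> inv_into U \<phi>)"
    by (rule smooth_on_subset[OF smooth_map_charts[OF f U VW(3)]]) auto
  have 2: "smooth_on (\<phi> ` ?R) (\<eta> \<circ> g \<circ> inv_into U \<phi>)"
    by (rule smooth_on_subset[OF smooth_map_charts[OF g U VW(4)]]) auto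
  show "smooth_on (\<phi> ` (S \<inter> U \<inter> (\<lambda>x. (f x, g x)) -` VW)) (\<lambda>x. \<omega> (f (inv_into U \<phi> x), g (inv_into U \<phi> x)))"
    unfolding VW R map_prod_simp using 1 2 Ck_on_Pair[OF oR] unfolding smooth_on_def o_def by blast
qed

lemma smooth_map_const:
  assumes "open S" shows "smooth_map \<A> \<B> S (\<lambda>_. c)"
  by (rule smooth_mapI) (auto simp: smooth_on_def Ck_on_const assms)

text \<open>For the identity, for charts and for inverse charts the expressions in coordinates are the
  transition maps of the atlas.\<close>

lemma smooth_map_ident:
  assumes "smooth_atlas \<A>" shows "smooth_map \<A> \<A> UNIV (\<lambda>x. x)"
proof (rule smooth_mapI)
  fix U \<phi> V \<psi> assume "(U, \<phi>) \<in> \<A>" "(V, \<psi>) \<in> \<A>"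
  then have "smooth_on (\<phi> ` (U \<inter> V)) (\<psi> \<circ> inv_into U \<phi>)"
    using assms unfolding smooth_atlas_def by blast
  then show "smooth_on (\<phi> ` (UNIV \<inter> U \<inter> (\<lambda>x. x) -` V)) (\<lambda>x. \<psi> (inv_into U \<phi> x))"
    by (simp add: o_def)
qed auto

lemma smooth_map_chart:
  fixes \<A> :: "('p::topological_space, 'e::euclidean_space) atlas"
  assumes "smooth_atlas \<A>" "(U, \<phi>) \<in> \<A>" shows "smooth_map \<A> std_atlas U \<phi>"
proof (rule smooth_mapI)
  note cover = chart_cover_smooth_atlas[OF assms(1)]
  show "open U" using chart_open[OF cover assms(2)] by auto
  show "continuous_on U \<phi>" using chart_homeomorphism[OF cover assms(2)] by (simp add: homeomorphism_def)
  fix V \<psi> W \<eta> assume "(V, \<psi>) \<in> \<A>" "(W, \<eta>) \<in> (std_atlas :: ('e, 'e) atlas)"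
  then have "smooth_on (\<psi> ` (V \<inter> U)) (\<phi> \<circ> inv_into V \<psi>)" "W = UNIV" "\<eta> = id"
    using assms unfolding smooth_atlas_def std_atlas_def by blast+
  then show "smooth_on (\<psi> ` (U \<inter> V \<inter> \<phi> -` W)) (\<lambda>x. \<eta> (\<phi> (inv_into V \<psi> x)))"
    by (simp add: o_def Int_commute)
qed

lemma smooth_map_chart_inv:
  fixes \<A> :: "('p::topological_space, 'e::euclidean_space) atlas"
  assumes "smooth_atlas \<A>" "(U, \<phi>) \<in> \<A>" shows "smooth_map std_atlas \<A> (\<phi> ` U) (inv_into U \<phi>)"
proof (rule smooth_mapI)
  note cover = chart_cover_smooth_atlas[OF assms(1)]
  show "open (\<phi> ` U)" using chart_open[OF cover assms(2)] by auto
  show "continuous_on (\<phi> ` U) (inv_into U \<phi>)"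
    using chart_homeomorphism[OF cover assms(2)] by (simp add: homeomorphism_def)
  fix V \<psi> W \<eta> assume V: "(V, \<psi>) \<in> \<A>" and "(W, \<eta>) \<in> (std_atlas :: ('e, 'e) atlas)"
  then have "smooth_on (\<phi> ` (U \<inter> V)) (\<psi> \<circ> inv_into U \<phi>)" "W = UNIV" "\<eta> = id"
    using assms unfolding smooth_atlas_def std_atlas_def by blast+
  moreover have "id ` (\<phi> ` U \<inter> UNIV \<inter> inv_into U \<phi> -` V) = \<phi> ` (U \<inter> V)"
    using chart_inv[OF cover assms(2)] by (auto simp: image_iff)
  ultimately show "smooth_on (\<eta> ` (\<phi> ` U \<inter> W \<inter> inv_into U \<phi> -` V)) (\<lambda>x. \<psi> (inv_into U \<phi> (inv_into W \<eta> x)))"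
    by (simp add: o_def inv_into_UNIV_id)
qed

section \<open>Tangent spaces\<close>

lemma smooth_map_bounded_linear:
  assumes "chart_cover \<A>" "smooth_map \<A> std_atlas S f" "bounded_linear L"
  shows "smooth_map \<A> std_atlas S (\<lambda>x. L (f x))"
proof -
  have L: "smooth_map std_atlas std_atlas UNIV L"
    using assms(3) by (simp add: smooth_map_std_iff smooth_on_bounded_linear)
  from smooth_map_compose[OF assms(1) chart_cover_std chart_cover_std assms(2) L] show ?thesis by simp
qed

lemma smooth_map_add:
  assumes "chart_cover \<A>" "smooth_map \<A> std_atlas S f" "smooth_map \<A> std_atlas S g"
  shows "smooth_map \<A> std_atlas S (\<lambda>x. f x + g x)"
proof -
  have "smooth_map \<A> std_atlas S (\<lambda>x. (f x, g x))"
    using smooth_map_Pair[OF assms(1) chart_cover_std chart_cover_std assms(2,3)]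
    unfolding prod_atlas_std .
  from smooth_map_bounded_linear[OF assms(1) this bounded_linear_add[OF bounded_linear_fst bounded_linear_snd]]
  show ?thesis by simp
qed

lemma smooth_map_lincomb:
  fixes f :: "'i \<Rightarrow> 'p::topological_space \<Rightarrow> real"
  assumes "chart_cover \<A>" "open S" "\<And>i. i \<in> K \<Longrightarrow> smooth_map \<A> std_atlas S (f i)"
  shows "smooth_map \<A> std_atlas S (\<lambda>x. \<Sum>i\<in>K. c i * f i x)"
  using assms(3)
proof (induction K rule: infinite_finite_induct)
  case (insert i K)
  have "smooth_map \<A> std_atlas S (\<lambda>x. c i * f i x + (\<Sum>i\<in>K. c i * f i x))"
    using insert
    by (intro smooth_map_add[OF assms(1)] smooth_map_bounded_linear[OF assms(1) _ bounded_linear_mult_right]) auto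
  then show ?case using insert by simp
qed (auto intro: smooth_map_const assms(2))

lemma smooth_on_differentiable: "smooth_on S f \<Longrightarrow> x \<in> S \<Longrightarrow> f differentiable (at x)"
  unfolding smooth_on_def by (metis Ck_on.simps(2))

text \<open>The directional derivative at \<open>p\<close> with coordinate vector \<open>w\<close> in a chart.\<close>

definition chart_vec ::
  "('p::topological_space, 'e::euclidean_space) atlas \<Rightarrow> 'p set \<Rightarrow> ('p \<Rightarrow> 'e) \<Rightarrow> 'p \<Rightarrow> 'e \<Rightarrow> 'p tvec" where
  "chart_vec \<A> U \<phi> p w =
     (\<lambda>f. if smooth_near \<A> p f then frechet_derivative (f \<circ> inv_into U \<phi>) (at (\<phi> p)) w else 0)"

context
  fixes \<A> :: "('p::topological_space, 'e::euclidean_space) atlas"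
  assumes atlas: "smooth_atlas \<A>"
begin

lemma atlas_chart_cover: "chart_cover \<A>"
  using atlas by (rule chart_cover_smooth_atlas)

lemma smooth_near_comp_curve:
  assumes "smooth_map std_atlas \<A> J \<gamma>" "smooth_map \<A> std_atlas S f"
  shows "open (J \<inter> \<gamma> -` S)" "smooth_on (J \<inter> \<gamma> -` S) (\<lambda>s. f (\<gamma> s))"
  using smooth_map_compose[OF chart_cover_std atlas_chart_cover chart_cover_std assms]
  by (simp_all add: smooth_map_std_iff)

lemma smooth_near_chart_differentiable:
  assumes "(U, \<phi>) \<in> \<A>" "p \<in> U" "smooth_near \<A> p f"
  shows "(f \<circ> inv_into U \<phi>) differentiable (at (\<phi> p))"
proof -
  obtain S where S: "p \<in> S" "smooth_map \<A> std_atlas S f"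
    using assms(3) unfolding smooth_near_def by blast
  from smooth_map_compose[OF chart_cover_std atlas_chart_cover chart_cover_std smooth_map_chart_inv[OF atlas assms(1)] S(2)]
  have "smooth_on (\<phi> ` U \<inter> inv_into U \<phi> -` S) (\<lambda>x. f (inv_into U \<phi> x))"
    by (simp add: smooth_map_std_iff)
  then show ?thesis
    using S(1) assms(2) chart_inv[OF atlas_chart_cover assms(1,2)] unfolding o_def
    by (auto intro: smooth_on_differentiable)
qed

lemma curve_has_derivative:
  assumes "(U, \<phi>) \<in> \<A>" "smooth_map std_atlas \<A> J \<gamma>" "s \<in> J" "\<gamma> s \<in> U" "smooth_near \<A> (\<gamma> s) f"
  shows "((\<lambda>s. f (\<gamma> s)) has_real_derivative
     frechet_derivative (f \<circ> inv_into U \<phi>) (at (\<phi> (\<gamma> s))) (vector_derivative (\<lambda>s. \<phi> (\<gamma> s)) (at s))) (at s)"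
proof -
  let ?F = "f \<circ> inv_into U \<phi>" and ?g = "\<lambda>s. \<phi> (\<gamma> s)"
  have F: "(?F has_derivative frechet_derivative ?F (at (?g s))) (at (?g s))"
    using smooth_near_chart_differentiable[OF assms(1,4,5)] by (simp add: frechet_derivative_works)
  note sm = smooth_near_comp_curve[OF assms(2) smooth_map_chart[OF atlas assms(1)]]
  have "?g differentiable (at s)"
    using sm(2) assms(3,4) by (auto intro: smooth_on_differentiable)
  then have "(?g has_vector_derivative vector_derivative ?g (at s)) (at s)"
    by (simp add: vector_derivative_works)
  from vector_derivative_diff_chain_within[OF this has_derivative_at_withinI[OF F]]
  have "(?F \<circ> ?g has_vector_derivative frechet_derivative ?F (at (?g s)) (vector_derivative ?g (at s))) (at s)" .
  then have "(?F \<circ> ?g has_real_derivative frechet_derivative ?F (at (?g s)) (vector_derivative ?g (at s))) (at s)"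
    by (simp add: has_real_derivative_iff_has_vector_derivative)
  then show ?thesis
  proof (rule DERIV_cong_ev[OF refl _ refl, THEN iffD1, rotated])
    have "\<forall>\<^sub>F x in nhds s. x \<in> J \<inter> \<gamma> -` U"
      using sm(1) assms(3,4) by (intro eventually_nhds_in_open) auto
    then show "\<forall>\<^sub>F x in nhds s. (?F \<circ> ?g) x = f (\<gamma> x)"
      by (rule eventually_mono) (auto simp: chart_inv[OF atlas_chart_cover assms(1)])
  qed
qed

lemma velocity_eq_chart_vec:
  assumes "(U, \<phi>) \<in> \<A>" "smooth_map std_atlas \<A> J \<gamma>" "s \<in> J" "\<gamma> s \<in> U"
  shows "velocity \<A> \<gamma> s = chart_vec \<A> U \<phi> (\<gamma> s) (vector_derivative (\<lambda>s. \<phi> (\<gamma> s)) (at s))"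
  using DERIV_imp_deriv[OF curve_has_derivative[OF assms]]
  by (auto simp: velocity_def chart_vec_def o_def)

lemma velocity_has_derivative:
  assumes "smooth_map std_atlas \<A> J \<gamma>" "s \<in> J" "smooth_near \<A> (\<gamma> s) f"
  shows "((\<lambda>s. f (\<gamma> s)) has_real_derivative velocity \<A> \<gamma> s f) (at s)"
proof -
  obtain U \<phi> where U: "(U, \<phi>) \<in> \<A>" "\<gamma> s \<in> U" using chart_at[OF atlas_chart_cover] by blast
  have "velocity \<A> \<gamma> s f =
      frechet_derivative (f \<circ> inv_into U \<phi>) (at (\<phi> (\<gamma> s))) (vector_derivative (\<lambda>s. \<phi> (\<gamma> s)) (at s))"
    unfolding velocity_eq_chart_vec[OF U(1) assms(1,2) U(2)] chart_vec_def using assms(3) by simp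
  then show ?thesis using curve_has_derivative[OF U(1) assms(1,2) U(2) assms(3)] by simp
qed

text \<open>Every coordinate vector \<open>w\<close> is realised by the curve that is the straight line \<open>\<phi>(p) + s w\<close> in the
  chart.  So the tangent space, defined as a set of velocities, is a linear space.\<close>

lemma tangent_space_eq_chart_vec:
  assumes U: "(U, \<phi>) \<in> \<A>" and p: "p \<in> U"
  shows "tangent_space \<A> p = range (chart_vec \<A> U \<phi> p)"
proof (rule subset_antisym; rule subsetI)
  fix v assume "v \<in> tangent_space \<A> p"
  then show "v \<in> range (chart_vec \<A> U \<phi> p)"
    using velocity_eq_chart_vec[OF U] p unfolding tangent_space_def by blast
next
  fix v assume "v \<in> range (chart_vec \<A> U \<phi> p)"
  then obtain w where w: "v = chart_vec \<A> U \<phi> p w" by blast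
  let ?l = "\<lambda>s::real. \<phi> p + s *\<^sub>R w"
  define \<gamma> where "\<gamma> = (\<lambda>s. inv_into U \<phi> (?l s))"
  have "smooth_map std_atlas std_atlas UNIV ?l"
    using Ck_on_affine[OF bounded_linear_scaleR_left open_UNIV]
    by (auto simp: smooth_map_std_iff smooth_on_def)
  from smooth_map_compose[OF chart_cover_std chart_cover_std atlas_chart_cover this smooth_map_chart_inv[OF atlas U]]
  have g: "smooth_map std_atlas \<A> (UNIV \<inter> ?l -` \<phi> ` U) \<gamma>" unfolding \<gamma>_def .
  have g0: "\<gamma> 0 = p" using p by (simp add: \<gamma>_def chart_inv[OF atlas_chart_cover U])
  have 0: "0 \<in> UNIV \<inter> ?l -` \<phi> ` U" using p by simp
  have "\<forall>\<^sub>F s in nhds 0. s \<in> UNIV \<inter> ?l -` \<phi> ` U"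
    using smooth_map_open[OF g] 0 by (rule eventually_nhds_in_open)
  then have ev: "\<forall>\<^sub>F s in nhds 0. ?l s = \<phi> (\<gamma> s)"
    by (rule eventually_mono) (auto simp: \<gamma>_def f_inv_into_f)
  have "(?l has_vector_derivative w) (at 0) = ((\<lambda>s. \<phi> (\<gamma> s)) has_vector_derivative w) (at 0)"
    by (rule has_vector_derivative_cong_ev) (use ev eventually_nhds_x_imp_x[OF ev] in auto)
  moreover have "(?l has_vector_derivative w) (at 0)"
    by (auto intro!: derivative_eq_intros simp: has_vector_derivative_def)
  ultimately have "((\<lambda>s. \<phi> (\<gamma> s)) has_vector_derivative w) (at 0)" by simp
  then have d: "vector_derivative (\<lambda>s. \<phi> (\<gamma> s)) (at 0) = w" by (rule vector_derivative_at)
  have "\<gamma> 0 \<in> U" using p by (simp only: g0)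
  from velocity_eq_chart_vec[OF U g 0 this] have "velocity \<A> \<gamma> 0 = v" unfolding d g0 w .
  then show "v \<in> tangent_space \<A> p" unfolding tangent_space_def
    by (intro CollectI exI[of _ \<gamma>] exI[of _ "UNIV \<inter> ?l -` \<phi> ` U"] conjI 0 g g0) simp
qed

lemma chart_vec_lincomb:
  assumes "(U, \<phi>) \<in> \<A>" "p \<in> U"
  shows "(\<lambda>f. a * chart_vec \<A> U \<phi> p v f + b * chart_vec \<A> U \<phi> p w f) = chart_vec \<A> U \<phi> p (a *\<^sub>R v + b *\<^sub>R w)"
proof
  fix f
  show "a * chart_vec \<A> U \<phi> p v f + b * chart_vec \<A> U \<phi> p w f = chart_vec \<A> U \<phi> p (a *\<^sub>R v + b *\<^sub>R w) f"
  proof (cases "smooth_near \<A> p f")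
    case True
    then have "linear (frechet_derivative (f \<circ> inv_into U \<phi>) (at (\<phi> p)))"
      using smooth_near_chart_differentiable[OF assms] by (intro linear_frechet_derivative)
    then show ?thesis using True by (simp add: chart_vec_def linear_add linear_scale)
  qed (simp add: chart_vec_def)
qed

lemma tangent_space_lincomb2:
  assumes "u \<in> tangent_space \<A> p" "v \<in> tangent_space \<A> p"
  shows "(\<lambda>f. a * u f + b * v f) \<in> tangent_space \<A> p"
proof -
  obtain U \<phi> where U: "(U, \<phi>) \<in> \<A>" "p \<in> U" using chart_at[OF atlas_chart_cover] by blast
  show ?thesis
    using assms unfolding tangent_space_eq_chart_vec[OF U] by (auto simp: chart_vec_lincomb[OF U])
qed

lemma tangent_space_zero: "(\<lambda>f. 0) \<in> tangent_space \<A> p"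
proof -
  obtain U \<phi> where U: "(U, \<phi>) \<in> \<A>" "p \<in> U" using chart_at[OF atlas_chart_cover] by blast
  have "chart_vec \<A> U \<phi> p 0 \<in> tangent_space \<A> p" unfolding tangent_space_eq_chart_vec[OF U] by blast
  from tangent_space_lincomb2[OF this this, of 0 0] show ?thesis by simp
qed

lemma tangent_space_sum:
  assumes "\<And>i. i \<in> K \<Longrightarrow> u i \<in> tangent_space \<A> p"
  shows "(\<lambda>f. \<Sum>i\<in>K. c i * u i f) \<in> tangent_space \<A> p"
  using assms
proof (induction K rule: infinite_finite_induct)
  case (insert i K)
  then show ?case using tangent_space_lincomb2[of "u i" p "\<lambda>f. \<Sum>i\<in>K. c i * u i f" "c i" 1] by simp
qed (auto intro: tangent_space_zero)

lemma tangent_vector_undefined: "u \<in> tangent_space \<A> p \<Longrightarrow> \<not> smooth_near \<A> p f \<Longrightarrow> u f = 0"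
  unfolding tangent_space_def by (auto simp: velocity_def)

lemma tangent_vector_const: "u \<in> tangent_space \<A> p \<Longrightarrow> u (\<lambda>_. c) = 0"
  unfolding tangent_space_def by (auto simp: velocity_def o_def)

lemma velocity_tangent:
  assumes "smooth_map std_atlas \<A> J \<gamma>" "s \<in> J"
  shows "velocity \<A> \<gamma> s \<in> tangent_space \<A> (\<gamma> s)"
proof -
  obtain U \<phi> where U: "(U, \<phi>) \<in> \<A>" "\<gamma> s \<in> U" using chart_at[OF atlas_chart_cover] by blast
  show ?thesis
    unfolding tangent_space_eq_chart_vec[OF U] velocity_eq_chart_vec[OF U(1) assms U(2)] by blast
qed

lemma smooth_map_coordinate:
  assumes "(U, \<phi>) \<in> \<A>" shows "smooth_map \<A> std_atlas U (\<lambda>q. \<phi> q \<bullet> b)"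
  using smooth_map_bounded_linear[OF atlas_chart_cover smooth_map_chart[OF atlas assms] bounded_linear_inner_left] .

lemma chart_vec_coordinate:
  assumes U: "(U, \<phi>) \<in> \<A>" and p: "p \<in> U"
  shows "chart_vec \<A> U \<phi> p w (\<lambda>q. \<phi> q \<bullet> b) = w \<bullet> b"
proof -
  have near: "smooth_near \<A> p (\<lambda>q. \<phi> q \<bullet> b)"
    using smooth_map_coordinate[OF U] p unfolding smooth_near_def by blast
  have "((\<lambda>x. x \<bullet> b) has_derivative (\<lambda>w. w \<bullet> b)) (at (\<phi> p))"
    by (rule bounded_linear_imp_has_derivative[OF bounded_linear_inner_left])
  then have "(((\<lambda>q. \<phi> q \<bullet> b) \<circ> inv_into U \<phi>) has_derivative (\<lambda>w. w \<bullet> b)) (at (\<phi> p))"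
    by (rule has_derivative_transform_within_open[OF _ chart_open(2)[OF atlas_chart_cover U]])
      (use p in \<open>auto simp: chart_inv[OF atlas_chart_cover U]\<close>)
  from fun_cong[OF frechet_derivative_at[OF this], of w] near show ?thesis
    unfolding chart_vec_def by (simp only: if_True)
qed

lemma tangent_vector_eqI:
  assumes "(U, \<phi>) \<in> \<A>" "p \<in> U" "u \<in> tangent_space \<A> p" "v \<in> tangent_space \<A> p"
    and "\<And>b. b \<in> Basis \<Longrightarrow> u (\<lambda>q. \<phi> q \<bullet> b) = v (\<lambda>q. \<phi> q \<bullet> b)"
  shows "u = v"
proof -
  obtain x y where xy: "u = chart_vec \<A> U \<phi> p x" "v = chart_vec \<A> U \<phi> p y"
    using assms(3,4) unfolding tangent_space_eq_chart_vec[OF assms(1,2)] by blast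
  have "x = y"
    by (rule euclidean_eqI) (use assms(5) in \<open>simp add: xy chart_vec_coordinate[OF assms(1,2)]\<close>)
  then show ?thesis by (simp add: xy)
qed

end

section \<open>Translations in a Lie group\<close>

lemma invertible_matrix_if_trivial_kernel:
  fixes M :: "real ^ 'n ^ 'n"
  assumes "\<And>c. M *v c = 0 \<Longrightarrow> c = 0"
  shows "det M \<noteq> 0"
  using assms matrix_left_invertible_ker[of M] invertible_left_inverse[of M] invertible_det_nz[of M] by blast

context
  fixes G :: "'g::{t2_space,second_countable_topology} monoid"
    and \<A> :: "('g, 'e::euclidean_space) atlas"
  assumes lie: "lie_group G \<A>"
begin

lemma group_atlas: "smooth_atlas \<A>"
  using lie by (simp add: lie_group_def)

lemma group_cover: "chart_cover \<A>"
  using group_atlas by (rule chart_cover_smooth_atlas)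

lemma mult_assoc: "(x \<otimes>\<^bsub>G\<^esub> y) \<otimes>\<^bsub>G\<^esub> z = x \<otimes>\<^bsub>G\<^esub> (y \<otimes>\<^bsub>G\<^esub> z)"
  and mult_one_left: "\<one>\<^bsub>G\<^esub> \<otimes>\<^bsub>G\<^esub> x = x" and mult_one_right: "x \<otimes>\<^bsub>G\<^esub> \<one>\<^bsub>G\<^esub> = x"
  and mult_inv: "x \<otimes>\<^bsub>G\<^esub> inv\<^bsub>G\<^esub> x = \<one>\<^bsub>G\<^esub>" and mult_inv_left: "inv\<^bsub>G\<^esub> x \<otimes>\<^bsub>G\<^esub> x = \<one>\<^bsub>G\<^esub>"
proof -
  interpret group G using lie by (simp add: lie_group_def)
  have c: "x \<in> carrier G" for x using lie by (simp add: lie_group_def)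
  show "(x \<otimes>\<^bsub>G\<^esub> y) \<otimes>\<^bsub>G\<^esub> z = x \<otimes>\<^bsub>G\<^esub> (y \<otimes>\<^bsub>G\<^esub> z)" "\<one>\<^bsub>G\<^esub> \<otimes>\<^bsub>G\<^esub> x = x" "x \<otimes>\<^bsub>G\<^esub> \<one>\<^bsub>G\<^esub> = x"
    "x \<otimes>\<^bsub>G\<^esub> inv\<^bsub>G\<^esub> x = \<one>\<^bsub>G\<^esub>" "inv\<^bsub>G\<^esub> x \<otimes>\<^bsub>G\<^esub> x = \<one>\<^bsub>G\<^esub>"
    by (auto simp: c m_assoc)
qed

lemma smooth_mult:
  assumes "chart_cover \<B>" "smooth_map \<B> \<A> S f" "smooth_map \<B> \<A> S g"
  shows "smooth_map \<B> \<A> S (\<lambda>x. f x \<otimes>\<^bsub>G\<^esub> g x)"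
proof -
  have "smooth_map (prod_atlas \<A> \<A>) \<A> UNIV (\<lambda>(x, y). x \<otimes>\<^bsub>G\<^esub> y)"
    using lie unfolding lie_group_def by (elim conjE)
  from smooth_map_compose[OF assms(1) chart_cover_prod[OF group_cover group_cover] group_cover
    smooth_map_Pair[OF assms(1) group_cover group_cover assms(2,3)] this]
  show ?thesis by simp
qed

lemma smooth_right_translation: "smooth_map \<A> \<A> UNIV (\<lambda>x. x \<otimes>\<^bsub>G\<^esub> a)"
  and smooth_left_translation: "smooth_map \<A> \<A> UNIV (\<lambda>x. a \<otimes>\<^bsub>G\<^esub> x)"
  by (intro smooth_mult group_cover smooth_map_ident[OF group_atlas] smooth_map_const open_UNIV)+

lemma smooth_near_compose:
  assumes "smooth_map \<A> \<A> UNIV F" "smooth_near \<A> (F p) f"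
  shows "smooth_near \<A> p (\<lambda>x. f (F x))"
proof -
  obtain S where "F p \<in> S" "smooth_map \<A> std_atlas S f"
    using assms(2) unfolding smooth_near_def by blast
  then show ?thesis
    using smooth_map_compose[OF group_cover group_cover chart_cover_std assms(1)]
    unfolding smooth_near_def by (intro exI[of _ "UNIV \<inter> F -` S"]) auto
qed

lemma smooth_near_right_translate: "smooth_near \<A> p (\<lambda>x. f (x \<otimes>\<^bsub>G\<^esub> a)) \<longleftrightarrow> smooth_near \<A> (p \<otimes>\<^bsub>G\<^esub> a) f"
proof
  assume *: "smooth_near \<A> p (\<lambda>x. f (x \<otimes>\<^bsub>G\<^esub> a))"
  have "smooth_near \<A> ((p \<otimes>\<^bsub>G\<^esub> a) \<otimes>\<^bsub>G\<^esub> inv\<^bsub>G\<^esub> a) (\<lambda>x. f (x \<otimes>\<^bsub>G\<^esub> a))"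
    using * by (simp add: mult_assoc mult_inv mult_one_right)
  from smooth_near_compose[OF smooth_right_translation this]
  show "smooth_near \<A> (p \<otimes>\<^bsub>G\<^esub> a) f" by (simp add: mult_assoc mult_inv_left mult_one_right)
qed (rule smooth_near_compose[OF smooth_right_translation])

lemma smooth_near_left_translate: "smooth_near \<A> p (\<lambda>x. f (a \<otimes>\<^bsub>G\<^esub> x)) \<longleftrightarrow> smooth_near \<A> (a \<otimes>\<^bsub>G\<^esub> p) f"
proof
  assume *: "smooth_near \<A> p (\<lambda>x. f (a \<otimes>\<^bsub>G\<^esub> x))"
  have "smooth_near \<A> (inv\<^bsub>G\<^esub> a \<otimes>\<^bsub>G\<^esub> (a \<otimes>\<^bsub>G\<^esub> p)) (\<lambda>x. f (a \<otimes>\<^bsub>G\<^esub> x))"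
    using * by (simp add: mult_assoc[symmetric] mult_inv_left mult_one_left)
  from smooth_near_compose[OF smooth_left_translation this]
  show "smooth_near \<A> (a \<otimes>\<^bsub>G\<^esub> p) f" by (simp add: mult_assoc[symmetric] mult_inv mult_one_left)
qed (rule smooth_near_compose[OF smooth_left_translation])

text \<open>The push forward of a velocity is the velocity of the translated curve; this includes the dummy value on
  functions that are not smooth, because translations are diffeomorphisms.\<close>

lemma right_translate_tangent:
  assumes "u \<in> tangent_space \<A> p"
  shows "diffeo_push (\<lambda>x. x \<otimes>\<^bsub>G\<^esub> a) u \<in> tangent_space \<A> (p \<otimes>\<^bsub>G\<^esub> a)"
proof -
  obtain \<gamma> J where g: "u = velocity \<A> \<gamma> 0" "0 \<in> J" "smooth_map std_atlas \<A> J \<gamma>" "\<gamma> 0 = p"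
    using assms unfolding tangent_space_def by auto
  have s: "smooth_map std_atlas \<A> J (\<lambda>s. \<gamma> s \<otimes>\<^bsub>G\<^esub> a)"
    by (intro smooth_mult chart_cover_std g(3) smooth_map_const smooth_map_open[OF g(3)])
  have "diffeo_push (\<lambda>x. x \<otimes>\<^bsub>G\<^esub> a) u = velocity \<A> (\<lambda>s. \<gamma> s \<otimes>\<^bsub>G\<^esub> a) 0"
    by (rule ext) (simp add: diffeo_push_def g(1) velocity_def o_def smooth_near_right_translate)
  then show ?thesis using velocity_tangent[OF group_atlas s g(2)] by (simp add: g(4))
qed

lemma lie_algebra_tangent: "X \<in> lie_algebra G \<A> \<Longrightarrow> X p \<in> tangent_space \<A> p"
  and lie_algebra_smooth: "X \<in> lie_algebra G \<A> \<Longrightarrow> smooth_map \<A> std_atlas S f \<Longrightarrow> smooth_map \<A> std_atlas S (\<lambda>p. X p f)"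
  unfolding lie_algebra_def smooth_vector_field_def by auto

lemma lie_algebra_translate: "X \<in> lie_algebra G \<A> \<Longrightarrow> X (a \<otimes>\<^bsub>G\<^esub> p) f = X p (\<lambda>x. f (a \<otimes>\<^bsub>G\<^esub> x))"
  unfolding lie_algebra_def by (simp add: diffeo_push_def o_def)

lemma lie_algebra_at: "X \<in> lie_algebra G \<A> \<Longrightarrow> X p f = X \<one>\<^bsub>G\<^esub> (\<lambda>x. f (p \<otimes>\<^bsub>G\<^esub> x))"
  using lie_algebra_translate[of X p "\<one>\<^bsub>G\<^esub>" f] by (simp add: mult_one_right)

lemma lie_bracket_at:
  assumes "X \<in> lie_algebra G \<A>" "Y \<in> lie_algebra G \<A>"
  shows "lie_bracket \<A> X Y p f = lie_bracket \<A> X Y \<one>\<^bsub>G\<^esub> (\<lambda>x. f (p \<otimes>\<^bsub>G\<^esub> x))"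
proof -
  have *: "X p (\<lambda>q. Y q f) = X \<one>\<^bsub>G\<^esub> (\<lambda>q. Y q (\<lambda>x. f (p \<otimes>\<^bsub>G\<^esub> x)))" if "X \<in> lie_algebra G \<A>" "Y \<in> lie_algebra G \<A>" for X Y
    by (simp only: lie_algebra_at[OF that(1), of p] lie_algebra_translate[OF that(2)])
  show ?thesis
    unfolding lie_bracket_def smooth_near_left_translate mult_one_right *[OF assms] *[OF assms(2,1)] ..
qed

text \<open>Both sides are mixed second derivatives at \<open>(0, 0)\<close> of \<open>(s, t) \<mapsto> f(\<gamma>(s) \<delta>(t))\<close>.  Differentiating in \<open>t\<close> gives
  the left invariant field through \<open>\<delta>'(0)\<close>, differentiating in \<open>s\<close> gives the right invariant field through
  \<open>\<gamma>'(0)\<close>; the equation says that these two fields commute at the unit.\<close>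

lemma left_right_derivatives_commute:
  assumes g: "smooth_map std_atlas \<A> J \<gamma>" "0 \<in> J" "\<gamma> 0 = \<one>\<^bsub>G\<^esub>"
    and d: "smooth_map std_atlas \<A> K \<delta>" "0 \<in> K" "\<delta> 0 = \<one>\<^bsub>G\<^esub>"
    and f: "smooth_map \<A> std_atlas S f" "\<one>\<^bsub>G\<^esub> \<in> S"
  shows "deriv (\<lambda>s. velocity \<A> \<delta> 0 (\<lambda>b. f (\<gamma> s \<otimes>\<^bsub>G\<^esub> b))) 0
       = deriv (\<lambda>t. velocity \<A> \<gamma> 0 (\<lambda>a. f (a \<otimes>\<^bsub>G\<^esub> \<delta> t))) 0"
    and "Ck_on n (K \<inter> \<delta> -` S) (\<lambda>t. velocity \<A> \<gamma> 0 (\<lambda>a. f (a \<otimes>\<^bsub>G\<^esub> \<delta> t)))"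
proof -
  define F where "F = (\<lambda>x. f (\<gamma> (fst x) \<otimes>\<^bsub>G\<^esub> \<delta> (snd x)))"
  have p: "smooth_map std_atlas std_atlas UNIV (fst :: real \<times> real \<Rightarrow> real)"
    "smooth_map std_atlas std_atlas UNIV (snd :: real \<times> real \<Rightarrow> real)"
    by (auto simp: smooth_map_std_iff smooth_on_bounded_linear bounded_linear_fst bounded_linear_snd)
  have JK: "open (J \<times> K)" using smooth_map_open g d open_Times by blast
  have "smooth_map std_atlas \<A> (J \<times> K) (\<lambda>x. \<gamma> (fst x))"
    using smooth_map_compose[OF chart_cover_std chart_cover_std group_cover p(1) g(1)]
    by (rule smooth_map_subset) (auto simp: JK)
  moreover have "smooth_map std_atlas \<A> (J \<times> K) (\<lambda>x. \<delta> (snd x))"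
    using smooth_map_compose[OF chart_cover_std chart_cover_std group_cover p(2) d(1)]
    by (rule smooth_map_subset) (auto simp: JK)
  ultimately have "smooth_map std_atlas \<A> (J \<times> K) (\<lambda>x. \<gamma> (fst x) \<otimes>\<^bsub>G\<^esub> \<delta> (snd x))"
    by (rule smooth_mult[OF chart_cover_std])
  from smooth_map_compose[OF chart_cover_std group_cover chart_cover_std this f(1)]
  have "smooth_map std_atlas std_atlas (J \<times> K \<inter> (\<lambda>x. \<gamma> (fst x) \<otimes>\<^bsub>G\<^esub> \<delta> (snd x)) -` S) F"
    unfolding F_def .
  moreover define R where "R = J \<times> K \<inter> (\<lambda>x. \<gamma> (fst x) \<otimes>\<^bsub>G\<^esub> \<delta> (snd x)) -` S"
  ultimately have R: "open R" "smooth_on R F" by (auto simp: smooth_map_std_iff)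
  have R0: "(0, t) \<in> R \<longleftrightarrow> t \<in> K \<inter> \<delta> -` S" "(s, 0) \<in> R \<longleftrightarrow> s \<in> J \<inter> \<gamma> -` S" for s t
    using g d by (auto simp: R_def mult_one_left mult_one_right)
  have C: "Ck_on n R F" for n using R by (simp add: smooth_on_def)
  have dF: "F differentiable (at x)" if "x \<in> R" for x using C[of "Suc 0"] that by auto
  have 1: "velocity \<A> \<gamma> 0 (\<lambda>a. f (a \<otimes>\<^bsub>G\<^esub> \<delta> t)) = frechet_derivative F (at (0, t)) (1, 0)" if "(0, t) \<in> R" for t
  proof -
    have "smooth_near \<A> (\<delta> t) f" using that R0 f(1) unfolding smooth_near_def by blast
    then have "smooth_near \<A> (\<gamma> 0) (\<lambda>a. f (a \<otimes>\<^bsub>G\<^esub> \<delta> t))"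
      by (simp add: smooth_near_right_translate g(3) mult_one_left)
    then show ?thesis
      using DERIV_imp_deriv[OF frechet_partial_derivatives(1)[OF dF[OF that]]]
      by (simp add: velocity_def o_def F_def)
  qed
  have 2: "velocity \<A> \<delta> 0 (\<lambda>b. f (\<gamma> s \<otimes>\<^bsub>G\<^esub> b)) = frechet_derivative F (at (s, 0)) (0, 1)" if "(s, 0) \<in> R" for s
  proof -
    have "smooth_near \<A> (\<gamma> s) f" using that R0 f(1) unfolding smooth_near_def by blast
    then have "smooth_near \<A> (\<delta> 0) (\<lambda>b. f (\<gamma> s \<otimes>\<^bsub>G\<^esub> b))"
      by (simp add: smooth_near_left_translate d(3) mult_one_right)
    then show ?thesis
      using DERIV_imp_deriv[OF frechet_partial_derivatives(2)[OF dF[OF that]]]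
      by (simp add: velocity_def o_def F_def)
  qed
  have oK: "open (K \<inter> \<delta> -` S)" and oJ: "open (J \<inter> \<gamma> -` S)"
    using smooth_near_comp_curve(1)[OF group_atlas _ f(1)] g d by blast+
  have evt: "\<forall>\<^sub>F t in nhds 0. t \<in> K \<inter> \<delta> -` S"
    using oK by (rule eventually_nhds_in_open) (use d f in auto)
  have evs: "\<forall>\<^sub>F s in nhds 0. s \<in> J \<inter> \<gamma> -` S"
    using oJ by (rule eventually_nhds_in_open) (use g f in auto)
  have "deriv (\<lambda>s. velocity \<A> \<delta> 0 (\<lambda>b. f (\<gamma> s \<otimes>\<^bsub>G\<^esub> b))) 0 = deriv (\<lambda>s. frechet_derivative F (at (s, 0)) (0, 1)) 0"
    by (rule deriv_cong_ev[OF eventually_mono[OF evs]]) (use 2 R0 in auto)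
  also have "\<dots> = deriv (\<lambda>t. frechet_derivative F (at (0, t)) (1, 0)) 0"
    by (rule mixed_partials_commute[symmetric, OF R(1) _ C]) (use R0 g d f in auto)
  also have "\<dots> = deriv (\<lambda>t. velocity \<A> \<gamma> 0 (\<lambda>a. f (a \<otimes>\<^bsub>G\<^esub> \<delta> t))) 0"
    by (rule deriv_cong_ev[OF eventually_mono[OF evt]]) (use 1 R0 in auto)
  finally show "deriv (\<lambda>s. velocity \<A> \<delta> 0 (\<lambda>b. f (\<gamma> s \<otimes>\<^bsub>G\<^esub> b))) 0
       = deriv (\<lambda>t. velocity \<A> \<gamma> 0 (\<lambda>a. f (a \<otimes>\<^bsub>G\<^esub> \<delta> t))) 0" .
  have "Ck_on n R (\<lambda>x. frechet_derivative F (at x) (1, 0))" using C[of "Suc n"] by simp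
  moreover have "Ck_on n (K \<inter> \<delta> -` S) (\<lambda>t::real. (0::real, t))"
    by (rule Ck_on_Pair[OF oK Ck_on_const]) (use Ck_on_affine[OF bounded_linear_ident oK, of n 0] in simp)
  ultimately have "Ck_on n (K \<inter> \<delta> -` S) (\<lambda>t. frechet_derivative F (at (0, t)) (1, 0))"
    using Ck_on_compose[OF oK R(1), where g = "\<lambda>t. (0, t)"] R0 by blast
  then show "Ck_on n (K \<inter> \<delta> -` S) (\<lambda>t. velocity \<A> \<gamma> 0 (\<lambda>a. f (a \<otimes>\<^bsub>G\<^esub> \<delta> t)))"
    by (rule Ck_on_cong[OF oK, rotated]) (use 1 R0 in auto)
qed

end

section \<open>Orthonormal left invariant frames\<close>

text \<open>Up to order there is only one triple of distinct indices, so a totally antisymmetric tensor is a multiple of the volume form.\<close>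

lemma antisymmetric_tensor_cross3:
  fixes c :: "3 \<Rightarrow> 3 \<Rightarrow> 3 \<Rightarrow> real"
  assumes "\<And>i j k. c i j k = - c j i k" "\<And>i j k. c i j k = - c k j i"
  shows "(\<Sum>i\<in>UNIV. \<Sum>j\<in>UNIV. t $ i * w $ j * c i j k) = c 1 2 3 * cross3 t w $ k"
proof -
  have z: "c i i k = 0" "c i j i = 0" "c i j j = 0" for i j k
    using assms(1)[of i i k] assms(2)[of i j i] assms(1)[of i j j] assms(2)[of j i j] by linarith+
  have e: "c 2 1 3 = - c 1 2 3" "c 3 2 1 = - c 1 2 3" "c 2 3 1 = c 1 2 3" "c 3 1 2 = c 1 2 3" "c 1 3 2 = - c 1 2 3"
    using assms(1)[of 1 2 3] assms(2)[of 1 2 3] assms(1)[of 2 3 1] assms(2)[of 2 1 3] assms(1)[of 1 3 2] by linarith+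
  have "k = 1 \<or> k = 2 \<or> k = 3" by (rule exhaust_3)
  then show ?thesis
    by (elim disjE) (simp_all add: sum_3 z e cross_components algebra_simps)
qed

context
  fixes G :: "'g::{t2_space,second_countable_topology} monoid"
    and \<A> :: "('g, real ^ 3) atlas"
    and m :: "'g \<Rightarrow> 'g tvec \<Rightarrow> 'g tvec \<Rightarrow> real"
    and E :: "3 \<Rightarrow> 'g vfield"
  assumes lie: "lie_group G \<A>"
    and metric: "bi_invariant_metric G \<A> m"
    and basis: "orthonormal_basis G \<A> m E"
begin

lemma E_lie_algebra: "E i \<in> lie_algebra G \<A>"
  using basis by (simp add: orthonormal_basis_def)

lemmas E_tangent = lie_algebra_tangent[OF lie E_lie_algebra]
  and E_smooth = lie_algebra_smooth[OF lie E_lie_algebra]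

lemma metric_sym: "u \<in> tangent_space \<A> p \<Longrightarrow> v \<in> tangent_space \<A> p \<Longrightarrow> m p u v = m p v u"
  using metric by (simp add: bi_invariant_metric_def riemannian_metric_def)

lemma metric_lincomb2:
  "u \<in> tangent_space \<A> p \<Longrightarrow> v \<in> tangent_space \<A> p \<Longrightarrow> w \<in> tangent_space \<A> p \<Longrightarrow>
   m p (\<lambda>f. a * u f + b * v f) w = a * m p u w + b * m p v w"
  using metric by (simp add: bi_invariant_metric_def riemannian_metric_def)

lemma metric_sum:
  assumes "\<And>i. i \<in> K \<Longrightarrow> u i \<in> tangent_space \<A> p" "w \<in> tangent_space \<A> p"
  shows "m p (\<lambda>f. \<Sum>i\<in>K. c i * u i f) w = (\<Sum>i\<in>K. c i * m p (u i) w)"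
proof -
  have zero: "m p (\<lambda>f. 0) w = 0"
    using metric_lincomb2[OF assms(2,2,2), of 0 0] by simp
  show ?thesis using assms(1)
  proof (induction K rule: infinite_finite_induct)
    case (insert i K)
    have "m p (\<lambda>f. c i * u i f + 1 * (\<Sum>i\<in>K. c i * u i f)) w
        = c i * m p (u i) w + 1 * m p (\<lambda>f. \<Sum>i\<in>K. c i * u i f) w"
      using insert by (intro metric_lincomb2 tangent_space_sum[OF group_atlas[OF lie]] assms(2)) auto
    then show ?case using insert by simp
  qed (simp_all add: zero)
qed

lemma frame_orthonormal: "m p (E i p) (E j p) = (if i = j then 1 else 0)"
proof -
  have push: "E i p = diffeo_push (\<lambda>x. p \<otimes>\<^bsub>G\<^esub> x) (E i \<one>\<^bsub>G\<^esub>)" for i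
    by (rule ext) (simp only: diffeo_push_def lie_algebra_at[OF lie E_lie_algebra, of i p] o_def)
  have "m p (E i p) (E j p) = m \<one>\<^bsub>G\<^esub> (E i \<one>\<^bsub>G\<^esub>) (E j \<one>\<^bsub>G\<^esub>)"
    using metric E_tangent[of _ "\<one>\<^bsub>G\<^esub>"] unfolding bi_invariant_metric_def
    by (metis push mult_one_right[OF lie])
  then show ?thesis using basis by (simp add: orthonormal_basis_def lie_inner_def)
qed

lemma lincomb_tangent: "lincomb E c p \<in> tangent_space \<A> p"
  unfolding lincomb_def by (intro tangent_space_sum[OF group_atlas[OF lie]] E_tangent)

lemma metric_lincomb_left:
  "w \<in> tangent_space \<A> p \<Longrightarrow> m p (lincomb E c p) w = (\<Sum>i\<in>UNIV. c $ i * m p (E i p) w)"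
  unfolding lincomb_def by (intro metric_sum E_tangent)

lemma lincomb_component: "m p (lincomb E c p) (E j p) = c $ j"
  by (simp add: metric_lincomb_left[OF E_tangent] frame_orthonormal if_distrib cong: if_cong)

lemma lincomb_inner: "m p (lincomb E c p) (lincomb E d p) = c \<bullet> d"
proof -
  have "m p (E i p) (lincomb E d p) = d $ i" for i
    using metric_sym[OF E_tangent lincomb_tangent] lincomb_component by metis
  then show ?thesis
    by (simp add: metric_lincomb_left[OF lincomb_tangent] inner_vec_def)
qed

lemma lincomb_eq_iff: "lincomb E c p = lincomb E d p \<longleftrightarrow> c = d"
  by (metis lincomb_component vec_eq_iff)

text \<open>Its columns are the chart coordinates of the frame.\<close>

definition frame_matrix :: "('g \<Rightarrow> real ^ 3) \<Rightarrow> 'g \<Rightarrow> real ^ 3 ^ 3" where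
  "frame_matrix \<phi> p = (\<chi> k i. E i p (\<lambda>q. \<phi> q $ k))"

lemma frame_matrix_vec: "frame_matrix \<phi> p *v c = (\<chi> k. lincomb E c p (\<lambda>q. \<phi> q $ k))"
  by (simp add: frame_matrix_def matrix_vector_mult_def lincomb_def mult.commute)

lemma tangent_vector_eqI_coordinates:
  assumes "(U, \<phi>) \<in> \<A>" "p \<in> U" "u \<in> tangent_space \<A> p" "v \<in> tangent_space \<A> p"
    and "\<And>k. u (\<lambda>q. \<phi> q $ k) = v (\<lambda>q. \<phi> q $ k)"
  shows "u = v"
proof (rule tangent_vector_eqI[OF group_atlas[OF lie] assms(1-4)])
  fix b :: "real ^ 3" assume "b \<in> Basis"
  then obtain k where "b = axis k 1" by (auto simp: Basis_vec_def)
  then show "u (\<lambda>q. \<phi> q \<bullet> b) = v (\<lambda>q. \<phi> q \<bullet> b)"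
    using assms(5)[of k] by (simp add: inner_axis)
qed

text \<open>An orthonormal frame is linearly independent, and a tangent vector with vanishing coordinates is zero.
  Since the model space also has dimension three, the frame spans every tangent space.\<close>

lemma frame_matrix_det:
  assumes "(U, \<phi>) \<in> \<A>" "p \<in> U" shows "det (frame_matrix \<phi> p) \<noteq> 0"
proof (rule invertible_matrix_if_trivial_kernel)
  fix c assume "frame_matrix \<phi> p *v c = 0"
  also have "0 = frame_matrix \<phi> p *v 0" by simp
  finally have "lincomb E c p (\<lambda>q. \<phi> q $ k) = lincomb E 0 p (\<lambda>q. \<phi> q $ k)" for k
    unfolding frame_matrix_vec by (simp add: vec_eq_iff)
  then have "lincomb E c p = lincomb E 0 p"
    by (rule tangent_vector_eqI_coordinates[OF assms lincomb_tangent lincomb_tangent])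
  then show "c = 0" by (simp only: lincomb_eq_iff)
qed

lemma frame_span:
  assumes "u \<in> tangent_space \<A> p"
  shows "u = lincomb E (\<chi> i. m p u (E i p)) p"
proof -
  obtain U \<phi> where U: "(U, \<phi>) \<in> \<A>" "p \<in> U"
    using chart_at[OF group_cover[OF lie]] by blast
  have "invertible (frame_matrix \<phi> p)"
    using frame_matrix_det[OF U] by (simp add: invertible_det_nz)
  then obtain M where "frame_matrix \<phi> p ** M = mat 1" by (auto simp: invertible_def)
  then have "frame_matrix \<phi> p *v (M *v (\<chi> k. u (\<lambda>q. \<phi> q $ k))) = (\<chi> k. u (\<lambda>q. \<phi> q $ k))"
    by (simp add: matrix_vector_mul_assoc)
  then obtain c where c: "frame_matrix \<phi> p *v c = (\<chi> k. u (\<lambda>q. \<phi> q $ k))" by blast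
  have u: "u = lincomb E c p"
    by (rule tangent_vector_eqI_coordinates[OF U assms lincomb_tangent])
      (use c in \<open>simp add: frame_matrix_vec vec_eq_iff\<close>)
  have "(\<chi> i. m p u (E i p)) = c" by (simp add: u lincomb_component vec_eq_iff)
  then show ?thesis using u by simp
qed

text \<open>Over a chart the frame components of a tangent vector solve a linear system, whose matrix and
  right hand side are the chart coordinates of the frame and of the vector.  Along a curve both are
  differentiable, hence so is the solution.\<close>

lemma frame_components_Ck:
  assumes U: "(U, \<phi>) \<in> \<A>" and g: "smooth_map std_atlas \<A> J \<gamma>"
    and S: "open S" "S \<subseteq> J \<inter> \<gamma> -` U"
    and u: "\<And>s. s \<in> S \<Longrightarrow> u s \<in> tangent_space \<A> (\<gamma> s)"
    and C: "\<And>k. Ck_on n S (\<lambda>s. u s (\<lambda>q. \<phi> q $ k))"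
  shows "Ck_on n S (\<lambda>s. m (\<gamma> s) (u s) (E i (\<gamma> s)))"
proof -
  let ?c = "\<lambda>s. \<chi> i. m (\<gamma> s) (u s) (E i (\<gamma> s))"
  have "Ck_on n S (\<lambda>s. ?c s $ i)"
  proof (rule Ck_on_linear_system[OF S(1)])
    fix k j
    have "smooth_map \<A> std_atlas U (\<lambda>q. \<phi> q $ k)"
      using smooth_map_coordinate[OF group_atlas[OF lie] U, of "axis k 1"] by (simp add: inner_axis)
    from smooth_near_comp_curve(2)[OF group_atlas[OF lie] g E_smooth[OF this]]
    have "Ck_on n (J \<inter> \<gamma> -` U) (\<lambda>s. E j (\<gamma> s) (\<lambda>q. \<phi> q $ k))"
      by (simp add: smooth_on_def)
    from Ck_on_subset[OF this S(2)] show "Ck_on n S (\<lambda>s. frame_matrix \<phi> (\<gamma> s) $ k $ j)"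
      by (simp add: frame_matrix_def)
    show "Ck_on n S (\<lambda>s. (\<chi> k. u s (\<lambda>q. \<phi> q $ k)) $ k)" using C by simp
  next
    fix s assume s: "s \<in> S"
    show "det (frame_matrix \<phi> (\<gamma> s)) \<noteq> 0" using frame_matrix_det[OF U] s S by blast
    show "frame_matrix \<phi> (\<gamma> s) *v ?c s = (\<chi> k. u s (\<lambda>q. \<phi> q $ k))"
      by (simp only: frame_matrix_vec frame_span[OF u[OF s], symmetric])
  qed
  then show ?thesis by simp
qed

text \<open>The infinitesimal form of bi-invariance, without the exponential map.  The right invariant fields
  \<open>X\<^sub>i\<close> with \<open>X\<^sub>i(1) = E\<^sub>i(1)\<close> are orthonormal, because the metric is right invariant, so
  \<open>X\<^sub>i = \<Sum>\<^sub>j \<rho>\<^sub>i\<^sub>j E\<^sub>j\<close> with \<open>\<rho>\<close> orthogonal and \<open>\<rho>(1)\<close> the unit matrix.  Left and right translations commute,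
  hence so do \<open>X\<^sub>i\<close> and \<open>E\<^sub>k\<close>.  Evaluating \<open>[X\<^sub>i, E\<^sub>k] = 0\<close> at the unit with the product rule gives
  \<open>[E\<^sub>i, E\<^sub>k] = \<Sum>\<^sub>j r\<^sub>i\<^sub>j E\<^sub>j\<close>, where \<open>r = E\<^sub>k \<rho>\<close> is skew because \<open>\<rho>\<close> is orthogonal.  As \<open>\<rho>\<close> is needed only along a
  curve \<open>\<delta>\<close> with velocity \<open>E\<^sub>k(1)\<close>, it is a function of the parameter of \<open>\<delta>\<close> below.\<close>

lemma bracket_frame_skew:
  "\<exists>r. (\<forall>i j. r i j = - r j i) \<and>
       (\<forall>i. lie_bracket \<A> (E i) (E k) \<one>\<^bsub>G\<^esub> = lincomb E (\<chi> j. r i j) \<one>\<^bsub>G\<^esub>)"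
proof -
  note at = group_atlas[OF lie]
  let ?e = "\<one>\<^bsub>G\<^esub>"
  have ex: "\<exists>\<gamma> J. E i ?e = velocity \<A> \<gamma> 0 \<and> smooth_map std_atlas \<A> J \<gamma> \<and> 0 \<in> J \<and> \<gamma> 0 = ?e" for i
    using E_tangent[of i ?e] unfolding tangent_space_def by auto
  then obtain \<delta> K where d: "E k ?e = velocity \<A> \<delta> 0" "smooth_map std_atlas \<A> K \<delta>" "0 \<in> K" "\<delta> 0 = ?e" by blast
  have d': "smooth_near \<A> ?e f \<Longrightarrow> ((\<lambda>s. f (\<delta> s)) has_real_derivative E k ?e f) (at 0)" for f
    using velocity_has_derivative[OF at d(2,3)] by (simp add: d)
  have near_E: "smooth_near \<A> ?e f \<Longrightarrow> smooth_near \<A> ?e (\<lambda>q. E i q f)" for f i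
    using E_smooth unfolding smooth_near_def by blast
  define X where "X i a = diffeo_push (\<lambda>x. x \<otimes>\<^bsub>G\<^esub> a) (E i ?e)" for i a
  have X: "X i a \<in> tangent_space \<A> a" for i a
    using right_translate_tangent[OF lie E_tangent[of i ?e], of a] by (simp add: X_def mult_one_left[OF lie])
  have Xf: "X i a f = E i ?e (\<lambda>x. f (x \<otimes>\<^bsub>G\<^esub> a))" for i a f
    by (simp add: X_def diffeo_push_def o_def)
  have X1: "X i ?e = E i ?e" for i by (rule ext) (simp add: Xf mult_one_right[OF lie])
  have XX: "m a (X i a) (X j a) = (if i = j then 1 else 0)" for i j a
  proof -
    have "m (?e \<otimes>\<^bsub>G\<^esub> a) (X i a) (X j a) = m ?e (E i ?e) (E j ?e)"
      using metric E_tangent[of _ ?e] unfolding bi_invariant_metric_def X_def by blast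
    then show ?thesis by (simp add: mult_one_left[OF lie] frame_orthonormal)
  qed
  define \<rho> where "\<rho> i t = (\<chi> j. m (\<delta> t) (X i (\<delta> t)) (E j (\<delta> t)))" for i t
  have X_rho: "X i (\<delta> t) = lincomb E (\<rho> i t) (\<delta> t)" for i t
    unfolding \<rho>_def by (rule frame_span[OF X])
  have orth: "\<rho> i t \<bullet> \<rho> j t = (if i = j then 1 else 0)" for i j t
    using XX[of "\<delta> t" i j] by (simp only: X_rho lincomb_inner)
  have rho0: "\<rho> i 0 $ j = (if i = j then 1 else 0)" for i j
    by (simp add: \<rho>_def d X1 frame_orthonormal)
  \<comment> \<open>Derivatives along a right translate of \<open>E i\<close> and along \<open>E k\<close> commute.\<close>
  have comm: "deriv (\<lambda>s. X i (\<delta> s) f) 0 = E i ?e (\<lambda>q. E k q f)"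
    and XCk: "Ck_on n (K \<inter> \<delta> -` S) (\<lambda>t. X i (\<delta> t) f)"
    if f: "smooth_map \<A> std_atlas S f" "?e \<in> S" for i f S n
  proof -
    obtain \<gamma> J where g: "E i ?e = velocity \<A> \<gamma> 0" "smooth_map std_atlas \<A> J \<gamma>" "0 \<in> J" "\<gamma> 0 = ?e"
      using ex by blast
    note c = left_right_derivatives_commute[OF lie g(2-4) d(2-4) f]
    show "Ck_on n (K \<inter> \<delta> -` S) (\<lambda>t. X i (\<delta> t) f)" using c(2) by (simp add: Xf g)
    have "smooth_near \<A> ?e f" using f unfolding smooth_near_def by blast
    then have "smooth_near \<A> (\<gamma> 0) (\<lambda>q. E k q f)" by (simp add: near_E g)
    from DERIV_imp_deriv[OF velocity_has_derivative[OF at g(2,3) this]]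
    have "E i ?e (\<lambda>q. E k q f) = deriv (\<lambda>s. E k (\<gamma> s) f) 0" by (simp only: g(1))
    also have "\<dots> = deriv (\<lambda>s. velocity \<A> \<delta> 0 (\<lambda>b. f (\<gamma> s \<otimes>\<^bsub>G\<^esub> b))) 0"
      by (simp only: lie_algebra_at[OF lie E_lie_algebra, of k "\<gamma> _"] d(1))
    also have "\<dots> = deriv (\<lambda>t. X i (\<delta> t) f) 0" by (simp only: c(1) Xf g(1))
    finally show "deriv (\<lambda>s. X i (\<delta> s) f) 0 = E i ?e (\<lambda>q. E k q f)" by simp
  qed
  define r where "r i j = deriv (\<lambda>t. \<rho> i t $ j) 0" for i j
  have r: "((\<lambda>t. \<rho> i t $ j) has_real_derivative r i j) (at 0)" for i j
  proof -
    obtain U \<phi> where U: "(U, \<phi>) \<in> \<A>" "?e \<in> U" using chart_at[OF group_cover[OF lie]] by blast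
    let ?S = "K \<inter> \<delta> -` U"
    have phi: "smooth_map \<A> std_atlas U (\<lambda>q. \<phi> q $ l)" for l
      using smooth_map_coordinate[OF at U(1), of "axis l 1"] by (simp add: inner_axis)
    have "Ck_on (Suc 0) ?S (\<lambda>t. m (\<delta> t) (X i (\<delta> t)) (E j (\<delta> t)))"
      by (rule frame_components_Ck[OF U(1) d(2) smooth_near_comp_curve(1)[OF at d(2) phi] order_refl X XCk[OF phi U(2)]])
    moreover have "0 \<in> ?S" using d U by simp
    ultimately have "(\<lambda>t. m (\<delta> t) (X i (\<delta> t)) (E j (\<delta> t))) differentiable (at 0)"
      unfolding Ck_on.simps by (elim conjE) (rule bspec)
    then have "(\<lambda>t. \<rho> i t $ j) differentiable (at 0)" unfolding \<rho>_def vec_lambda_beta .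
    then show ?thesis unfolding r_def by (rule DERIV_deriv_iff_real_differentiable[THEN iffD2])
  qed
  have skew: "r i j = - r j i" for i j
  proof -
    have "((\<lambda>t. \<Sum>l\<in>UNIV. \<rho> i t $ l * \<rho> j t $ l) has_real_derivative
        (\<Sum>l\<in>UNIV. r i l * \<rho> j 0 $ l + r j l * \<rho> i 0 $ l)) (at 0)"
      by (intro DERIV_sum DERIV_mult r)
    then have "((\<lambda>t. if i = j then 1 else 0) has_real_derivative
        (\<Sum>l\<in>UNIV. r i l * \<rho> j 0 $ l + r j l * \<rho> i 0 $ l)) (at 0)"
      using orth[of i _ j] by (simp only: inner_vec_def inner_real_def)
    from DERIV_unique[OF this DERIV_const] have "(\<Sum>l\<in>UNIV. r i l * \<rho> j 0 $ l + r j l * \<rho> i 0 $ l) = 0" .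
    moreover have "(\<Sum>l\<in>UNIV. r i l * \<rho> j 0 $ l + r j l * \<rho> i 0 $ l) = r i j + r j i"
      by (simp add: rho0 sum.distrib if_distrib[of "(*) _"] cong: if_cong)
    ultimately show ?thesis by linarith
  qed
  have "lie_bracket \<A> (E i) (E k) ?e f = lincomb E (\<chi> j. r i j) ?e f" for i f
  proof (cases "smooth_near \<A> ?e f")
    case True
    then obtain S where S: "smooth_map \<A> std_atlas S f" "?e \<in> S" unfolding smooth_near_def by blast
    have "((\<lambda>t. \<Sum>j\<in>UNIV. \<rho> i t $ j * E j (\<delta> t) f) has_real_derivative
        (\<Sum>j\<in>UNIV. r i j * E j (\<delta> 0) f + E k ?e (\<lambda>q. E j q f) * \<rho> i 0 $ j)) (at 0)"
      by (intro DERIV_sum DERIV_mult r d' near_E True)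
    then have "deriv (\<lambda>t. X i (\<delta> t) f) 0 = (\<Sum>j\<in>UNIV. r i j * E j ?e f + E k ?e (\<lambda>q. E j q f) * \<rho> i 0 $ j)"
      by (simp only: DERIV_imp_deriv X_rho lincomb_def d(4))
    also have "\<dots> = (\<Sum>j\<in>UNIV. r i j * E j ?e f) + E k ?e (\<lambda>q. E i q f)"
      unfolding rho0 sum.distrib by (simp add: if_distrib[of "(*) _"] cong: if_cong)
    finally show ?thesis using True by (simp add: lie_bracket_def comm[OF S] lincomb_def)
  next
    case False
    then show ?thesis using tangent_vector_undefined[OF at lincomb_tangent] by (simp add: lie_bracket_def)
  qed
  with skew show ?thesis by (intro exI[of _ r]) blast
qed

definition structure_constant :: "3 \<Rightarrow> 3 \<Rightarrow> 3 \<Rightarrow> real" where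
  "structure_constant i j k = m \<one>\<^bsub>G\<^esub> (lie_bracket \<A> (E i) (E j) \<one>\<^bsub>G\<^esub>) (E k \<one>\<^bsub>G\<^esub>)"

text \<open>The bracket is again left invariant, so the coefficients found at the unit are valid everywhere.\<close>

lemma bracket_frame: "lie_bracket \<A> (E i) (E j) p = lincomb E (\<chi> k. structure_constant i j k) p"
proof
  fix f
  obtain r where r: "lie_bracket \<A> (E i) (E j) \<one>\<^bsub>G\<^esub> = lincomb E (\<chi> k. r i k) \<one>\<^bsub>G\<^esub>"
    using bracket_frame_skew[of j] by blast
  have "structure_constant i j k = r i k" for k
    by (simp add: structure_constant_def r lincomb_component)
  then show "lie_bracket \<A> (E i) (E j) p f = lincomb E (\<chi> k. structure_constant i j k) p f"
    by (simp add: lie_bracket_at[OF lie E_lie_algebra E_lie_algebra, of i j p] r lincomb_def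
      lie_algebra_at[OF lie E_lie_algebra, of _ p])
qed

text \<open>Skewness in the outer indices comes from bi-invariance, skewness in the first two from the bracket;
  together they make the structure constants totally antisymmetric.\<close>

lemma structure_constant_skew:
  "structure_constant i j k = - structure_constant j i k" "structure_constant i j k = - structure_constant k j i"
proof -
  obtain r where r: "\<And>i k. r i k = - r k i"
    "\<And>i. lie_bracket \<A> (E i) (E j) \<one>\<^bsub>G\<^esub> = lincomb E (\<chi> k. r i k) \<one>\<^bsub>G\<^esub>"
    using bracket_frame_skew[of j] by blast
  have "structure_constant i j k = r i k" for i k
    by (simp add: structure_constant_def r(2) lincomb_component)
  then show "structure_constant i j k = - structure_constant k j i"
    by (simp only: r(1)[of i k])
  have "lie_bracket \<A> (E i) (E j) \<one>\<^bsub>G\<^esub> f = - lie_bracket \<A> (E j) (E i) \<one>\<^bsub>G\<^esub> f" for f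
    by (simp add: lie_bracket_def)
  then have "lincomb E (\<chi> k. structure_constant i j k) \<one>\<^bsub>G\<^esub> = lincomb E (\<chi> k. - structure_constant j i k) \<one>\<^bsub>G\<^esub>"
    by (simp add: bracket_frame fun_eq_iff lincomb_def sum_negf)
  then show "structure_constant i j k = - structure_constant j i k"
    by (simp add: lincomb_eq_iff vec_eq_iff)
qed

text \<open>The formula \<open>D\<^sub>X Y = [X, Y] / 2\<close> on the Lie algebra.  The products \<open>\<langle>E\<^sub>j, E\<^sub>k\<rangle>\<close> are constant, so compatibility
  makes \<open>\<Gamma>\<close> skew in the last two indices, while vanishing torsion makes its antisymmetric part in the first
  two equal to the structure constants.\<close>

lemma levi_civita_frame:
  assumes D: "levi_civita \<A> m D"
  shows "D (E i) (E j) p = lincomb E (\<chi> k. structure_constant i j k / 2) p"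
proof -
  have E: "smooth_vector_field \<A> (E i)" for i using E_lie_algebra[of i] by (simp add: lie_algebra_def)
  define \<Gamma> where "\<Gamma> i j k = m p (D (E i) (E j) p) (E k p)" for i j k
  have tan: "D (E i) (E j) p \<in> tangent_space \<A> p" for i j
    using D[unfolded levi_civita_def, THEN conjunct1, rule_format, OF E E, of i j]
    by (simp add: smooth_vector_field_def)
  have DG: "D (E i) (E j) p = lincomb E (\<chi> k. \<Gamma> i j k) p" for i j
    unfolding \<Gamma>_def by (rule frame_span[OF tan])
  have tors: "\<Gamma> i j k - \<Gamma> j i k = structure_constant i j k" for i j k
  proof -
    have "(\<lambda>p f. D (E i) (E j) p f - D (E j) (E i) p f) = lie_bracket \<A> (E i) (E j)"
      by (rule D[unfolded levi_civita_def, THEN conjunct2, THEN conjunct2, THEN conjunct2, THEN conjunct1,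
            rule_format, OF E E])
    then have "(\<lambda>f. D (E i) (E j) p f - D (E j) (E i) p f) = lie_bracket \<A> (E i) (E j) p" by metis
    then have "lincomb E (\<chi> k. \<Gamma> i j k - \<Gamma> j i k) p = lincomb E (\<chi> k. structure_constant i j k) p"
      by (simp add: DG bracket_frame fun_eq_iff lincomb_def left_diff_distrib sum_subtractf)
    then show ?thesis by (simp add: lincomb_eq_iff vec_eq_iff)
  qed
  have compat: "\<Gamma> i j k = - \<Gamma> i k j" for i j k
  proof -
    have "E i p (\<lambda>q. m q (E j q) (E k q)) = m p (D (E i) (E j) p) (E k p) + m p (E j p) (D (E i) (E k) p)"
      by (rule D[unfolded levi_civita_def, THEN conjunct2, THEN conjunct2, THEN conjunct2, THEN conjunct2,
            rule_format, OF E E E])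
    moreover have "E i p (\<lambda>q. m q (E j q) (E k q)) = 0"
      unfolding frame_orthonormal by (rule tangent_vector_const[OF group_atlas[OF lie] E_tangent])
    ultimately show ?thesis by (simp add: \<Gamma>_def metric_sym[OF E_tangent tan])
  qed
  \<comment> \<open>The Koszul formula; two of its three terms cancel by total antisymmetry.\<close>
  have koszul: "\<Gamma> i j k = structure_constant i j k / 2" for i j k
    using tors[of i j k] tors[of j k i] tors[of k i j] compat[of i j k] compat[of j k i] compat[of k i j]
      structure_constant_skew(2)[of j k i] structure_constant_skew(1)[of k i j]
    by linarith
  show ?thesis by (simp only: DG koszul)
qed

lemma bracket_cross3:
  "(\<lambda>f. \<Sum>i\<in>UNIV. \<Sum>j\<in>UNIV. t $ i * w $ j * lie_bracket \<A> (E i) (E j) p f)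
   = lincomb E (structure_constant 1 2 3 *\<^sub>R cross3 t w) p"
  unfolding bracket_frame lincomb_def
proof
  fix f
  have "(\<Sum>i\<in>UNIV. \<Sum>j\<in>UNIV. t $ i * w $ j * (\<Sum>k\<in>UNIV. (\<chi> k. structure_constant i j k) $ k * E k p f))
      = (\<Sum>k\<in>UNIV. (\<Sum>i\<in>UNIV. \<Sum>j\<in>UNIV. t $ i * w $ j * structure_constant i j k) * E k p f)"
    by (simp add: sum_3 algebra_simps)
  also have "\<dots> = (\<Sum>k\<in>UNIV. (structure_constant 1 2 3 *\<^sub>R cross3 t w) $ k * E k p f)"
    by (simp add: antisymmetric_tensor_cross3[of structure_constant, OF structure_constant_skew])
  finally show "(\<Sum>i\<in>UNIV. \<Sum>j\<in>UNIV. t $ i * w $ j * (\<Sum>k\<in>UNIV. (\<chi> k. structure_constant i j k) $ k * E k p f))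
      = (\<Sum>k\<in>UNIV. (structure_constant 1 2 3 *\<^sub>R cross3 t w) $ k * E k p f)" .
qed

lemma levi_civita_cross3:
  assumes "levi_civita \<A> m D"
  shows "(\<lambda>f. \<Sum>i\<in>UNIV. \<Sum>j\<in>UNIV. t $ i * w $ j * D (E i) (E j) p f)
   = lincomb E ((structure_constant 1 2 3 / 2) *\<^sub>R cross3 t w) p"
proof
  fix f
  have half: "D (E i) (E j) p f = lie_bracket \<A> (E i) (E j) p f / 2" for i j
    unfolding levi_civita_frame[OF assms] bracket_frame lincomb_def by (simp add: sum_divide_distrib)
  have "(\<Sum>i\<in>UNIV. \<Sum>j\<in>UNIV. t $ i * w $ j * D (E i) (E j) p f)
     = (\<Sum>i\<in>UNIV. \<Sum>j\<in>UNIV. t $ i * w $ j * lie_bracket \<A> (E i) (E j) p f) / 2"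
    by (simp only: half times_divide_eq_right sum_divide_distrib)
  also have "\<dots> = lincomb E (structure_constant 1 2 3 *\<^sub>R cross3 t w) p f / 2"
    by (simp only: fun_cong[OF bracket_cross3])
  also have "\<dots> = lincomb E ((structure_constant 1 2 3 / 2) *\<^sub>R cross3 t w) p f"
    by (simp add: lincomb_def sum_divide_distrib)
  finally show "(\<Sum>i\<in>UNIV. \<Sum>j\<in>UNIV. t $ i * w $ j * D (E i) (E j) p f)
     = lincomb E ((structure_constant 1 2 3 / 2) *\<^sub>R cross3 t w) p f" .
qed

lemma lincomb_lie_algebra: "lincomb E c \<in> lie_algebra G \<A>"
  unfolding lie_algebra_def smooth_vector_field_def
proof (intro CollectI conjI allI impI)
  show "lincomb E c p \<in> tangent_space \<A> p" for p by (rule lincomb_tangent)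
  show "smooth_map \<A> std_atlas S (\<lambda>p. lincomb E c p f)" if "smooth_map \<A> std_atlas S f" for S f
    unfolding lincomb_def
    by (intro smooth_map_lincomb group_cover[OF lie] smooth_map_open[OF that] E_smooth[OF that])
  show "lincomb E c (a \<otimes>\<^bsub>G\<^esub> p) = diffeo_push (\<lambda>x. a \<otimes>\<^bsub>G\<^esub> x) (lincomb E c p)" for a p
    by (rule ext) (simp add: lincomb_def diffeo_push_def o_def lie_algebra_translate[OF lie E_lie_algebra])
qed

end

section \<open>Frenet systems in three-space\<close>

lemma has_vector_derivative_vec:
  fixes f :: "real \<Rightarrow> real ^ 'n"
  assumes "\<And>i. ((\<lambda>x. f x $ i) has_real_derivative d $ i) (at x)"
  shows "(f has_vector_derivative d) (at x)"
  unfolding has_vector_derivative_def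
proof (subst has_derivative_componentwise_within, rule ballI)
  fix b :: "real ^ 'n" assume "b \<in> Basis"
  then obtain i where b: "b = axis i 1" by (auto simp: Basis_vec_def)
  show "((\<lambda>x. f x \<bullet> b) has_derivative (\<lambda>h. (h *\<^sub>R d) \<bullet> b)) (at x)"
    using assms[of i] by (simp add: b inner_axis has_field_derivative_def mult.commute[of _ "d $ i"])
qed

text \<open>The square of the triple product \<open>(t \<times> n) \<bullet> x\<close> is the Gram determinant of \<open>t\<close>, \<open>n\<close>, \<open>x\<close>.\<close>

lemma cross3_frame_parseval:
  fixes t n x :: "real ^ 3"
  assumes "t \<bullet> t = 1" "n \<bullet> n = 1" "t \<bullet> n = 0"
  shows "(t \<bullet> x)\<^sup>2 + (n \<bullet> x)\<^sup>2 + (cross3 t n \<bullet> x)\<^sup>2 = x \<bullet> x"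
proof -
  have "(cross3 t n \<bullet> x)\<^sup>2 = (t \<bullet> t) * ((n \<bullet> n) * (x \<bullet> x) - (n \<bullet> x)\<^sup>2) - (t \<bullet> n) * ((t \<bullet> n) * (x \<bullet> x) - (n \<bullet> x) * (t \<bullet> x))
     + (t \<bullet> x) * ((t \<bullet> n) * (n \<bullet> x) - (n \<bullet> n) * (t \<bullet> x))"
    by (simp add: cross_components inner_vec_def sum_3 power2_eq_square) algebra
  then show ?thesis by (simp add: assms power2_eq_square)
qed

text \<open>The components of the Frenet frame in a left invariant frame satisfy the Frenet equations of a space
  curve with curvature \<open>\<kappa>\<close> and torsion \<open>\<kappa> H\<close>.\<close>

locale frenet_system =
  fixes I :: "real set" and t n b :: "real \<Rightarrow> real ^ 3" and \<kappa> H :: "real \<Rightarrow> real"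
  assumes I: "open I" "is_interval I" "I \<noteq> {}"
    and t': "s \<in> I \<Longrightarrow> (t has_vector_derivative \<kappa> s *\<^sub>R n s) (at s)"
    and n': "s \<in> I \<Longrightarrow> (n has_vector_derivative - \<kappa> s *\<^sub>R t s + (\<kappa> s * H s) *\<^sub>R b s) (at s)"
    and b': "s \<in> I \<Longrightarrow> (b has_vector_derivative - (\<kappa> s * H s) *\<^sub>R n s) (at s)"
    and H': "s \<in> I \<Longrightarrow> (H has_real_derivative deriv H s) (at s)"
    and tt: "s \<in> I \<Longrightarrow> t s \<bullet> t s = 1" and nn: "s \<in> I \<Longrightarrow> n s \<bullet> n s = 1"
    and tn: "s \<in> I \<Longrightarrow> t s \<bullet> n s = 0" and b: "s \<in> I \<Longrightarrow> b s = cross3 (t s) (n s)"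
    and \<kappa>: "s \<in> I \<Longrightarrow> \<kappa> s > 0"
begin

lemma one_plus_H_powr: "(1 + (H s)\<^sup>2) powr (3/2) = (1 + (H s)\<^sup>2) * sqrt (1 + (H s)\<^sup>2)"
proof -
  have "(1 + (H s)\<^sup>2) powr (1 + 1/2) = (1 + (H s)\<^sup>2) powr 1 * (1 + (H s)\<^sup>2) powr (1/2)"
    by (rule powr_add)
  then show ?thesis by (simp add: powr_half_sqrt)
qed

lemma cos_nonzero: "\<theta> \<in> {0..pi} \<Longrightarrow> \<theta> \<noteq> pi / 2 \<Longrightarrow> cos \<theta> \<noteq> 0"
  using cos_inj_pi[of \<theta> "pi / 2"] by auto

text \<open>Differentiating \<open>n \<bullet> x = cos \<theta>\<close> gives \<open>t \<bullet> x = H (b \<bullet> x)\<close>, and differentiating this gives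
  \<open>H' (b \<bullet> x) = \<kappa> cos \<theta> (1 + H\<^sup>2)\<close>.  Since \<open>x\<close> has unit length, \<open>(b \<bullet> x)\<^sup>2 (1 + H\<^sup>2) = sin\<^sup>2 \<theta>\<close>.  As \<open>cos \<theta> \<noteq> 0\<close>, neither
  \<open>H'\<close> nor \<open>b \<bullet> x\<close> has a zero, and the sign of \<open>b \<bullet> x\<close>, constant on the interval, decides whether the slope is
  the tangent of \<open>\<theta>\<close> or of \<open>\<pi> - \<theta>\<close>.\<close>

lemma slope_if_constant_angle:
  assumes x: "x \<bullet> x = 1" and \<theta>: "\<theta> \<in> {0..pi}" "\<theta> \<noteq> pi / 2" and angle: "\<And>s. s \<in> I \<Longrightarrow> n s \<bullet> x = cos \<theta>"
  shows "\<exists>\<theta>\<in>{0..pi}. \<theta> \<noteq> pi / 2 \<and>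
      (\<forall>s\<in>I. deriv H s \<noteq> 0 \<and> \<kappa> s * (1 + (H s)\<^sup>2) powr (3/2) / deriv H s = tan \<theta>)"
proof -
  let ?a = "\<lambda>s. t s \<bullet> x" and ?b = "\<lambda>s. b s \<bullet> x"
  have c: "cos \<theta> \<noteq> 0" using cos_nonzero \<theta> by blast
  have pos: "1 + (H s)\<^sup>2 > 0" for s by (simp add: add_pos_nonneg)
  have inner': "((\<lambda>s. f s \<bullet> x) has_real_derivative f' \<bullet> x) (at s)"
    if "(f has_vector_derivative f') (at s)" for f :: "real \<Rightarrow> real ^ 3" and f' s
    using bounded_linear.has_vector_derivative[OF bounded_linear_inner_left that]
    by (simp add: has_real_derivative_iff_has_vector_derivative)
  have local: "D = D'" if "(f has_real_derivative D) (at s)" "(g has_real_derivative D') (at s)"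
    "\<And>s. s \<in> I \<Longrightarrow> f s = g s" "s \<in> I" for f g :: "real \<Rightarrow> real" and D D' s
    using DERIV_unique[OF has_field_derivative_transform_within_open[OF that(1) I(1) that(4,3)] that(2)] by simp
  have a: "?a s = H s * ?b s" if s: "s \<in> I" for s
  proof -
    have "(- \<kappa> s *\<^sub>R t s + (\<kappa> s * H s) *\<^sub>R b s) \<bullet> x = 0"
      by (rule local[OF inner'[OF n'[OF s]] DERIV_const angle s])
    then have "\<kappa> s * (H s * ?b s - ?a s) = 0" by (simp add: inner_add_left algebra_simps)
    then show ?thesis using \<kappa>[OF s] by simp
  qed
  have H'b: "deriv H s * ?b s = \<kappa> s * cos \<theta> * (1 + (H s)\<^sup>2)" if s: "s \<in> I" for s
  proof -
    have "(\<kappa> s *\<^sub>R n s) \<bullet> x = deriv H s * ?b s + (- (\<kappa> s * H s) *\<^sub>R n s) \<bullet> x * H s"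
      by (rule local[OF inner'[OF t'[OF s]] DERIV_mult[OF H'[OF s] inner'[OF b'[OF s]]] a s])
    then show ?thesis by (simp add: angle[OF s] power2_eq_square algebra_simps)
  qed
  have b2: "(?b s * sqrt (1 + (H s)\<^sup>2))\<^sup>2 = (sin \<theta>)\<^sup>2" if s: "s \<in> I" for s
  proof -
    have "(?a s)\<^sup>2 + (cos \<theta>)\<^sup>2 + (?b s)\<^sup>2 = 1"
      using cross3_frame_parseval[OF tt[OF s] nn[OF s] tn[OF s], of x] x angle[OF s] b[OF s] by simp
    then show ?thesis using pos[of s]
      by (simp add: a[OF s] sin_squared_eq power_mult_distrib algebra_simps)
  qed
  have nz: "deriv H s \<noteq> 0" "?b s \<noteq> 0" if s: "s \<in> I" for s
    using H'b[OF s] \<kappa>[OF s] c pos[of s] by auto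
  have slope: "\<kappa> s * (1 + (H s)\<^sup>2) powr (3/2) / deriv H s = ?b s * sqrt (1 + (H s)\<^sup>2) / cos \<theta>" if s: "s \<in> I" for s
  proof -
    have "\<kappa> s * (1 + (H s)\<^sup>2) * cos \<theta> = deriv H s * ?b s" using H'b[OF s] by (simp add: mult_ac)
    then have "\<kappa> s * (1 + (H s)\<^sup>2) * sqrt (1 + (H s)\<^sup>2) * cos \<theta> = ?b s * sqrt (1 + (H s)\<^sup>2) * deriv H s"
      by (simp add: mult_ac)
    then show ?thesis using nz(1)[OF s] c unfolding one_plus_H_powr by (simp add: frac_eq_eq mult_ac)
  qed
  have conn: "connected (?b ` I)"
    by (rule connected_continuous_image[OF continuous_at_imp_continuous_on is_interval_connected[OF I(2)]])
      (use DERIV_isCont[OF inner'[OF b']] in blast)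
  have sign: "(\<forall>s\<in>I. ?b s > 0) \<or> (\<forall>s\<in>I. ?b s < 0)"
  proof (rule ccontr)
    assume "\<not> ((\<forall>s\<in>I. ?b s > 0) \<or> (\<forall>s\<in>I. ?b s < 0))"
    then obtain r s where rs: "r \<in> I" "s \<in> I" "?b r \<le> 0" "0 \<le> ?b s" by (auto simp: not_less)
    have "0 \<in> ?b ` I"
      by (rule connectedD_interval[OF conn imageI[OF rs(1)] imageI[OF rs(2)] rs(3,4)])
    then show False using nz(2) by auto
  qed
  have sin: "sin \<theta> \<ge> 0" using \<theta> by (auto intro: sin_ge_zero)
  from sign show ?thesis
  proof
    assume p: "\<forall>s\<in>I. ?b s > 0"
    have "?b s * sqrt (1 + (H s)\<^sup>2) = sin \<theta>" if s: "s \<in> I" for s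
    proof (rule power2_eq_imp_eq[OF b2[OF s] _ sin])
      show "0 \<le> ?b s * sqrt (1 + (H s)\<^sup>2)"
        using bspec[OF p s] pos[of s] by (intro mult_nonneg_nonneg) auto
    qed
    then show ?thesis using \<theta> nz slope by (intro bexI[of _ \<theta>]) (auto simp: tan_def)
  next
    assume p: "\<forall>s\<in>I. ?b s < 0"
    have "- (?b s * sqrt (1 + (H s)\<^sup>2)) = sin \<theta>" if s: "s \<in> I" for s
    proof (rule power2_eq_imp_eq[OF _ _ sin])
      show "(- (?b s * sqrt (1 + (H s)\<^sup>2)))\<^sup>2 = (sin \<theta>)\<^sup>2" using b2[OF s] by simp
      have "?b s * sqrt (1 + (H s)\<^sup>2) \<le> 0"
        using bspec[OF p s] pos[of s] by (intro mult_nonpos_nonneg) auto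
      then show "0 \<le> - (?b s * sqrt (1 + (H s)\<^sup>2))" by simp
    qed
    then have "?b s * sqrt (1 + (H s)\<^sup>2) = - sin \<theta>" if "s \<in> I" for s
      using that by (metis minus_minus)
    then show ?thesis using \<theta> nz slope by (intro bexI[of _ "pi - \<theta>"]) (auto simp: tan_def)
  qed
qed

text \<open>The computation of the previous proof leaves only one candidate for the axis, namely \<open>V\<close> below.  The
  hypothesis on the slope is exactly what makes its derivative vanish.\<close>

lemma constant_angle_if_slope:
  assumes \<theta>: "\<theta> \<in> {0..pi}" "\<theta> \<noteq> pi / 2"
    and nz: "\<And>s. s \<in> I \<Longrightarrow> deriv H s \<noteq> 0"
    and slope: "\<And>s. s \<in> I \<Longrightarrow> \<kappa> s * (1 + (H s)\<^sup>2) powr (3/2) / deriv H s = tan \<theta>"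
  shows "\<exists>x. x \<bullet> x = 1 \<and> (\<forall>s\<in>I. n s \<bullet> x = cos \<theta>)"
proof -
  let ?w = "\<lambda>s. sqrt (1 + (H s)\<^sup>2)"
  define \<beta> where "\<beta> s = sin \<theta> / ?w s" for s
  define V where "V s = (H s * \<beta> s) *\<^sub>R t s + cos \<theta> *\<^sub>R n s + \<beta> s *\<^sub>R b s" for s
  have c: "cos \<theta> \<noteq> 0" using cos_nonzero \<theta> by blast
  have pos: "1 + (H s)\<^sup>2 > 0" for s by (simp add: add_pos_nonneg)
  have w: "?w s > 0" "?w s * ?w s = 1 + (H s)\<^sup>2" for s using pos[of s] by auto
  have key: "sin \<theta> * deriv H s = \<kappa> s * cos \<theta> * (?w s * ?w s * ?w s)" if s: "s \<in> I" for s
  proof -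
    have "\<kappa> s * ((1 + (H s)\<^sup>2) * ?w s) / deriv H s = sin \<theta> / cos \<theta>"
      using slope[OF s] unfolding one_plus_H_powr tan_def .
    then show ?thesis using nz[OF s] c by (simp add: frac_eq_eq w(2) mult_ac)
  qed
  have \<beta>': "(\<beta> has_real_derivative - (\<kappa> s * H s * cos \<theta>)) (at s)" if s: "s \<in> I" for s
  proof -
    have w': "(?w has_real_derivative H s * deriv H s / ?w s) (at s)"
      using pos[of s] w(1)[of s] H'[OF s]
      by (auto intro!: derivative_eq_intros simp: field_simps)
    have "?w s \<noteq> 0" using w(1)[of s] by simp
    from DERIV_divide[OF DERIV_const w' this, of "sin \<theta>"]
    have "(\<beta> has_real_derivative - (sin \<theta> * (H s * deriv H s / ?w s)) / (?w s * ?w s)) (at s)"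
      unfolding \<beta>_def[abs_def] mult_zero_left diff_0 .
    moreover have "- (sin \<theta> * (H s * deriv H s / ?w s)) / (?w s * ?w s)
        = - (H s * (sin \<theta> * deriv H s) / (?w s * ?w s * ?w s))"
      by (simp add: mult_ac)
    moreover have "\<dots> = - (\<kappa> s * H s * cos \<theta>)"
    proof -
      have cancel: "- (h * (k * c * (w * w * w)) / (w * w * w)) = - (k * h * c)" if "w \<noteq> 0" for h k c w :: real
        using that by (simp add: field_simps)
      show ?thesis unfolding key[OF s] by (rule cancel) (use w(1)[of s] in simp)
    qed
    ultimately show ?thesis by simp
  qed
  have H\<beta>': "((\<lambda>s. H s * \<beta> s) has_real_derivative \<kappa> s * cos \<theta>) (at s)" if s: "s \<in> I" for s
  proof -
    have "deriv H s * \<beta> s = sin \<theta> * deriv H s / ?w s" by (simp add: \<beta>_def)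
    also have "\<dots> = \<kappa> s * cos \<theta> * (?w s * ?w s)" unfolding key[OF s] using w(1)[of s] by simp
    finally have "deriv H s * \<beta> s + - (\<kappa> s * H s * cos \<theta>) * H s = \<kappa> s * cos \<theta>"
      unfolding w(2) by (simp add: power2_eq_square algebra_simps)
    then show ?thesis using DERIV_mult[OF H'[OF s] \<beta>'[OF s]] by simp
  qed
  have "(V has_vector_derivative 0) (at s)" if s: "s \<in> I" for s
  proof -
    have "(V has_vector_derivative
        ((H s * \<beta> s) *\<^sub>R (\<kappa> s *\<^sub>R n s) + (\<kappa> s * cos \<theta>) *\<^sub>R t s)
        + cos \<theta> *\<^sub>R (- \<kappa> s *\<^sub>R t s + (\<kappa> s * H s) *\<^sub>R b s)
        + (\<beta> s *\<^sub>R (- (\<kappa> s * H s) *\<^sub>R n s) + (- (\<kappa> s * H s * cos \<theta>)) *\<^sub>R b s)) (at s)"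
      unfolding V_def[abs_def]
      by (intro has_vector_derivative_add has_vector_derivative_scaleR H\<beta>' \<beta>' t' b' s
          bounded_linear.has_vector_derivative[OF bounded_linear_scaleR_right] n')
    moreover have "((H s * \<beta> s) *\<^sub>R (\<kappa> s *\<^sub>R n s) + (\<kappa> s * cos \<theta>) *\<^sub>R t s)
        + cos \<theta> *\<^sub>R (- \<kappa> s *\<^sub>R t s + (\<kappa> s * H s) *\<^sub>R b s)
        + (\<beta> s *\<^sub>R (- (\<kappa> s * H s) *\<^sub>R n s) + (- (\<kappa> s * H s * cos \<theta>)) *\<^sub>R b s) = 0"
      by (simp add: vec_eq_iff algebra_simps)
    ultimately show ?thesis by simp
  qed
  then obtain x where x: "\<And>s. s \<in> I \<Longrightarrow> V s = x"
    using has_vector_derivative_zero_constant[of I V] I(2) is_interval_convex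
    by (metis has_vector_derivative_at_within)
  have bb: "b s \<bullet> t s = 0" "b s \<bullet> n s = 0" "b s \<bullet> b s = 1" if s: "s \<in> I" for s
    using tn[OF s] tt[OF s] nn[OF s]
    by (simp_all add: b[OF s] dot_cross_self dot_cross inner_commute)
  show ?thesis
  proof (intro exI conjI ballI)
    show "n s \<bullet> x = cos \<theta>" if s: "s \<in> I" for s
      using bb[OF s] nn[OF s] tn[OF s] unfolding x[OF s, symmetric] V_def
      by (simp add: inner_add_right inner_commute)
    obtain s where s: "s \<in> I" using I(3) by blast
    have "V s \<bullet> V s = (t s \<bullet> V s)\<^sup>2 + (n s \<bullet> V s)\<^sup>2 + (b s \<bullet> V s)\<^sup>2"
      using cross3_frame_parseval[OF tt[OF s] nn[OF s] tn[OF s], of "V s"] b[OF s] by simp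
    also have "\<dots> = (H s * \<beta> s)\<^sup>2 + (cos \<theta>)\<^sup>2 + (\<beta> s)\<^sup>2"
      using bb[OF s] nn[OF s] tn[OF s] tt[OF s] unfolding V_def by (simp add: inner_add_right inner_commute)
    also have "\<dots> = (\<beta> s * ?w s)\<^sup>2 + (cos \<theta>)\<^sup>2"
      using w(2)[of s] by (simp add: power_mult_distrib algebra_simps power2_eq_square)
    also have "\<beta> s * ?w s = sin \<theta>" using w(1)[of s] by (simp add: \<beta>_def)
    finally show "x \<bullet> x = 1" using x[OF s] by simp
  qed
qed

lemma constant_angle_iff_slope:
  "(\<exists>x. x \<bullet> x = 1 \<and> (\<exists>\<theta>\<in>{0..pi}. \<theta> \<noteq> pi / 2 \<and> (\<forall>s\<in>I. n s \<bullet> x = cos \<theta>))) \<longleftrightarrow>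
   (\<exists>\<theta>\<in>{0..pi}. \<theta> \<noteq> pi / 2 \<and>
      (\<forall>s\<in>I. deriv H s \<noteq> 0 \<and> \<kappa> s * (1 + (H s)\<^sup>2) powr (3/2) / deriv H s = tan \<theta>))"
  (is "?L \<longleftrightarrow> ?R")
proof
  show "?L \<Longrightarrow> ?R" using slope_if_constant_angle by (elim exE conjE bexE) blast
  assume ?R
  then obtain \<theta> where "\<theta> \<in> {0..pi}" "\<theta> \<noteq> pi / 2"
    "\<And>s. s \<in> I \<Longrightarrow> deriv H s \<noteq> 0" "\<And>s. s \<in> I \<Longrightarrow> \<kappa> s * (1 + (H s)\<^sup>2) powr (3/2) / deriv H s = tan \<theta>"
    by blast
  with constant_angle_if_slope[OF this] show ?L by blast
qed

end

section \<open>The Frenet apparatus in a left invariant frame\<close>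

lemma components_lincomb:
  fixes \<A> :: "('g::{t2_space,second_countable_topology}, real ^ 3) atlas" and W :: "real \<Rightarrow> 'g tvec"
  assumes "lie_group G \<A>" "bi_invariant_metric G \<A> m" "orthonormal_basis G \<A> m E"
    and "W s \<in> tangent_space \<A> (\<alpha> s)"
  shows "W s = lincomb E (components m E \<alpha> W s) (\<alpha> s)"
  using frame_span[OF assms] by (simp add: components_def)

locale frenet_curve_in_lie_group =
  fixes G :: "'g::{t2_space,second_countable_topology} monoid"
    and \<A> :: "('g, real ^ 3) atlas"
    and m :: "'g \<Rightarrow> 'g tvec \<Rightarrow> 'g tvec \<Rightarrow> real"
    and D :: "'g vfield \<Rightarrow> 'g vfield \<Rightarrow> 'g vfield"
    and E :: "3 \<Rightarrow> 'g vfield"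
    and I :: "real set"
    and \<alpha> :: "real \<Rightarrow> 'g"
    and T N B :: "real \<Rightarrow> 'g tvec"
    and \<kappa> \<tau> H :: "real \<Rightarrow> real"
  assumes lie: "lie_group G \<A>"
    and metric: "bi_invariant_metric G \<A> m"
    and D: "levi_civita \<A> m D"
    and basis: "orthonormal_basis G \<A> m E"
    and I: "open I" "is_interval I" "I \<noteq> {}"
    and curve: "unit_speed_curve \<A> m I \<alpha>"
    and frenet: "frenet_apparatus \<A> m D E I \<alpha> T N B \<kappa> \<tau>"
    and H: "\<And>s. s \<in> I \<Longrightarrow> H s = (\<tau> s - group_torsion \<A> m E \<alpha> T N B s) / \<kappa> s"
begin

abbreviation "frame_of \<equiv> lincomb E"
abbreviation "t \<equiv> components m E \<alpha> T"
abbreviation "n \<equiv> components m E \<alpha> N"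
abbreviation "b \<equiv> components m E \<alpha> B"
abbreviation "c \<equiv> structure_constant G \<A> m E 1 2 3"

lemma frenet_at:
  assumes "s \<in> I"
  shows "T s \<in> tangent_space \<A> (\<alpha> s)" "N s \<in> tangent_space \<A> (\<alpha> s)" "B s \<in> tangent_space \<A> (\<alpha> s)"
    "m (\<alpha> s) (T s) (T s) = 1" "m (\<alpha> s) (N s) (N s) = 1" "m (\<alpha> s) (B s) (B s) = 1"
    "m (\<alpha> s) (T s) (N s) = 0" "T s = velocity \<A> \<alpha> s" "B s = cross_along m E \<alpha> T N s"
    "\<kappa> s = sqrt (m (\<alpha> s) (dot_along m E \<alpha> T s) (dot_along m E \<alpha> T s))" "\<kappa> s > 0"
    "cov_along \<A> m D E \<alpha> T s = (\<lambda>f. \<kappa> s * N s f)"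
    "cov_along \<A> m D E \<alpha> N s = (\<lambda>f. - \<kappa> s * T s f + \<tau> s * B s f)"
    "cov_along \<A> m D E \<alpha> B s = (\<lambda>f. - \<tau> s * N s f)"
  using bspec[OF frenet[unfolded frenet_apparatus_def] assms] by - (elim conjE, assumption)+

lemmas lincomb_inner' = lincomb_inner[OF lie metric basis] and lincomb_eq_iff' = lincomb_eq_iff[OF lie metric basis]

lemma frame_expansion:
  assumes "s \<in> I"
  shows "T s = frame_of (t s) (\<alpha> s)" "N s = frame_of (n s) (\<alpha> s)" "B s = frame_of (b s) (\<alpha> s)"
  using frenet_at[OF assms] by (intro components_lincomb[OF lie metric basis]; simp)+

lemma components_orthonormal:
  assumes "s \<in> I"
  shows "t s \<bullet> t s = 1" "n s \<bullet> n s = 1" "t s \<bullet> n s = 0" "b s = cross3 (t s) (n s)"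
proof -
  note f = frenet_at[OF assms, unfolded frame_expansion[OF assms]]
  show "t s \<bullet> t s = 1" "n s \<bullet> n s = 1" "t s \<bullet> n s = 0"
    using f(4,5,7) by (simp_all only: lincomb_inner')
  show "b s = cross3 (t s) (n s)"
    using f(9) by (simp only: cross_along_def lincomb_eq_iff')
qed

abbreviation dot :: "(real \<Rightarrow> real ^ 3) \<Rightarrow> real \<Rightarrow> real ^ 3" where
  "dot w s \<equiv> (\<chi> i. deriv (\<lambda>u. w u $ i) s)"

lemma lincomb_add_scale:
  "(\<lambda>f. frame_of v p f + frame_of w p f) = frame_of (v + w) p"
  "(\<lambda>f. r * frame_of v p f) = frame_of (r *\<^sub>R v) p"
  "(\<lambda>f. r * frame_of v p f + q * frame_of w p f) = frame_of (r *\<^sub>R v + q *\<^sub>R w) p"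
  by (simp_all add: lincomb_def fun_eq_iff sum.distrib[symmetric] sum_distrib_left algebra_simps)

text \<open>In components the covariant derivative is the ordinary one plus \<open>(c / 2) t \<times> w\<close>, because
  \<open>[E\<^sub>i, E\<^sub>j]\<close> is \<open>c\<close> times the cross product of the basis vectors.\<close>

lemma cov_along_components:
  assumes "s \<in> I"
  shows "cov_along \<A> m D E \<alpha> W s =
    frame_of (dot (components m E \<alpha> W) s + (c / 2) *\<^sub>R cross3 (t s) (components m E \<alpha> W s)) (\<alpha> s)"
proof -
  have "components m E \<alpha> (velocity \<A> \<alpha>) s = t s"
    using frenet_at(8)[OF assms] by (simp add: components_def)
  then show ?thesis
    unfolding cov_along_def dot_along_def lincomb_add_scale(1)[symmetric]
      levi_civita_cross3[OF lie metric basis D, symmetric] by simp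
qed

lemma group_torsion_const:
  assumes "s \<in> I"
  shows "group_torsion \<A> m E \<alpha> T N B s = c / 2"
proof -
  have "bracket_along \<A> m E \<alpha> T N s = frame_of (c *\<^sub>R cross3 (t s) (n s)) (\<alpha> s)"
    unfolding bracket_along_def by (rule bracket_cross3[OF lie metric basis])
  moreover have "cross3 (t s) (n s) \<bullet> cross3 (t s) (n s) = 1"
    using components_orthonormal[OF assms] by (simp add: dot_cross inner_commute)
  ultimately show ?thesis
    unfolding group_torsion_def frame_expansion(3)[OF assms] components_orthonormal(4)[OF assms]
    by (simp add: lincomb_inner')
qed

text \<open>The correction \<open>(c / 2) t \<times> w\<close> vanishes for \<open>w = t\<close>, and for \<open>w = n\<close> and \<open>w = b\<close> it is \<open>(c / 2) b\<close> and
  \<open>- (c / 2) n\<close>.  So it only shifts the torsion by \<open>c / 2 = \<tau>\<^sub>G\<close>, and \<open>\<tau> - \<tau>\<^sub>G = \<kappa> H\<close>.\<close>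

lemma dot_frenet:
  assumes s: "s \<in> I"
  shows "dot t s = \<kappa> s *\<^sub>R n s"
    and "dot n s = - \<kappa> s *\<^sub>R t s + (\<kappa> s * H s) *\<^sub>R b s"
    and "dot b s = - (\<kappa> s * H s) *\<^sub>R n s"
    and "\<kappa> s = sqrt (dot t s \<bullet> dot t s)"
proof -
  note f = frenet_at[OF s, unfolded frame_expansion[OF s] cov_along_components[OF s] lincomb_add_scale]
  have \<tau>: "\<tau> s = \<kappa> s * H s + c / 2"
    using f(11) H[OF s] group_torsion_const[OF s] by (simp add: field_simps)
  note o = components_orthonormal[OF s]
  have tb: "cross3 (t s) (b s) = - n s"
    using o by (simp add: Lagrange)
  have "dot t s + (c / 2) *\<^sub>R cross3 (t s) (t s) = \<kappa> s *\<^sub>R n s"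
    using f(12) by (simp only: lincomb_eq_iff')
  then show "dot t s = \<kappa> s *\<^sub>R n s" by (simp add: cross_refl)
  have "dot n s + (c / 2) *\<^sub>R cross3 (t s) (n s) = - \<kappa> s *\<^sub>R t s + \<tau> s *\<^sub>R b s"
    using f(13) by (simp only: lincomb_eq_iff')
  then show "dot n s = - \<kappa> s *\<^sub>R t s + (\<kappa> s * H s) *\<^sub>R b s"
    unfolding o(4)[symmetric] \<tau> by (simp add: scaleR_left_distrib algebra_simps)
  have "dot b s + (c / 2) *\<^sub>R cross3 (t s) (b s) = - \<tau> s *\<^sub>R n s"
    using f(14) by (simp only: lincomb_eq_iff')
  then show "dot b s = - (\<kappa> s * H s) *\<^sub>R n s"
    unfolding tb \<tau> by (simp add: scaleR_left_distrib algebra_simps)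
  show "\<kappa> s = sqrt (dot t s \<bullet> dot t s)"
    using f(10) by (simp only: dot_along_def lincomb_inner')
qed

text \<open>The chart coordinates of the velocity are the derivatives of the chart coordinates of the curve.

  The derivatives in the Frenet equations are those of \<^const>\<open>deriv\<close>, which has some value at every point.
  That the frame and \<open>H\<close> really are differentiable has to be deduced from the smoothness of the curve, by
  solving the Frenet equations successively for \<open>\<kappa>\<close>, \<open>n\<close>, \<open>b\<close> and \<open>H\<close>.\<close>

lemma tangent_components_Ck: "Ck_on k I (\<lambda>s. t s $ i)"
proof (rule Ck_on_local)
  fix s assume s: "s \<in> I"
  have \<alpha>: "smooth_map std_atlas \<A> I \<alpha>" using curve by (simp add: unit_speed_curve_def)
  obtain U \<phi> where U: "(U, \<phi>) \<in> \<A>" "\<alpha> s \<in> U" using chart_at[OF group_cover[OF lie]] by blast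
  let ?S = "I \<inter> \<alpha> -` U"
  have phi: "smooth_map \<A> std_atlas U (\<lambda>q. \<phi> q $ l)" for l
    using smooth_map_coordinate[OF group_atlas[OF lie] U(1), of "axis l 1"] by (simp add: inner_axis)
  note curve_phi = smooth_near_comp_curve[OF group_atlas[OF lie] \<alpha> phi]
  have "Ck_on k ?S (\<lambda>u. T u (\<lambda>q. \<phi> q $ l))" for l
  proof (rule Ck_on_cong[OF curve_phi(1)])
    show "Ck_on k ?S (deriv (\<lambda>u. \<phi> (\<alpha> u) $ l))"
      using curve_phi(2)[of l] by (intro Ck_on_real_deriv[OF curve_phi(1)]) (simp add: smooth_on_def)
    fix u assume u: "u \<in> ?S"
    then have "smooth_near \<A> (\<alpha> u) (\<lambda>q. \<phi> q $ l)" using phi unfolding smooth_near_def by blast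
    then show "deriv (\<lambda>u. \<phi> (\<alpha> u) $ l) u = T u (\<lambda>q. \<phi> q $ l)"
      using u frenet_at(8)[of u] by (simp add: velocity_def o_def)
  qed
  then have "Ck_on k ?S (\<lambda>u. m (\<alpha> u) (T u) (E i (\<alpha> u)))"
    using frenet_at(1) by (intro frame_components_Ck[OF lie metric basis U(1) \<alpha> curve_phi(1) order_refl]) auto
  then show "\<exists>S. open S \<and> s \<in> S \<and> Ck_on k S (\<lambda>s. t s $ i)"
    using curve_phi(1) U(2) s by (intro exI[of _ ?S]) (simp add: components_def)
qed

lemma curvature_Ck: "Ck_on k I \<kappa>"
proof (rule Ck_on_cong[OF I(1)])
  have "Ck_on k I (\<lambda>s. deriv (\<lambda>u. t u $ i) s)" for i
    using Ck_on_real_deriv(2)[OF I(1) tangent_components_Ck] by simp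
  then have "Ck_on k I (\<lambda>s. \<Sum>i\<in>UNIV. deriv (\<lambda>u. t u $ i) s * deriv (\<lambda>u. t u $ i) s)"
    by (intro Ck_on_sum Ck_on_mult I)
  then show "Ck_on k I (\<lambda>s. sqrt (dot t s \<bullet> dot t s))"
    using frenet_at(11) dot_frenet(4) by (intro Ck_on_sqrt I) (auto simp: inner_vec_def)
qed (use dot_frenet(4) in simp)

lemma normal_components_Ck: "Ck_on k I (\<lambda>s. n s $ i)"
proof (rule Ck_on_cong[OF I(1)])
  show "Ck_on k I (\<lambda>s. deriv (\<lambda>u. t u $ i) s * inverse (\<kappa> s))"
    using Ck_on_real_deriv(2)[OF I(1) tangent_components_Ck] frenet_at(11)
    by (intro Ck_on_mult Ck_on_inverse curvature_Ck I) force+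
  fix s assume s: "s \<in> I"
  have "deriv (\<lambda>u. t u $ i) s = dot t s $ i" by simp
  also have "\<dots> = \<kappa> s * n s $ i" unfolding dot_frenet(1)[OF s] by simp
  finally show "deriv (\<lambda>u. t u $ i) s * inverse (\<kappa> s) = n s $ i"
    using frenet_at(11)[OF s] by simp
qed

lemma binormal_components_Ck: "Ck_on k I (\<lambda>s. b s $ i)"
proof (rule Ck_on_cong[OF I(1)])
  have sub: "Ck_on k I (\<lambda>s. t s $ j * n s $ l + (-1) * (n s $ j * t s $ l))" for j l
    by (intro Ck_on_add Ck_on_mult Ck_on_const I tangent_components_Ck normal_components_Ck)
  have "i = 1 \<or> i = 2 \<or> i = 3" by (rule exhaust_3)
  then show "Ck_on k I (\<lambda>s. cross3 (t s) (n s) $ i)"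
  proof (elim disjE)
    show "Ck_on k I (\<lambda>s. cross3 (t s) (n s) $ i)" if "i = 1" using sub[of 2 3] by (simp add: that cross_components)
    show "Ck_on k I (\<lambda>s. cross3 (t s) (n s) $ i)" if "i = 2" using sub[of 3 1] by (simp add: that cross_components)
    show "Ck_on k I (\<lambda>s. cross3 (t s) (n s) $ i)" if "i = 3" using sub[of 1 2] by (simp add: that cross_components)
  qed
qed (use components_orthonormal(4) in simp)

lemma harmonic_curvature_Ck: "Ck_on k I H"
proof (rule Ck_on_cong[OF I(1)])
  show "Ck_on k I (\<lambda>s. (\<Sum>i\<in>UNIV. deriv (\<lambda>u. n u $ i) s * b s $ i) * inverse (\<kappa> s))"
    using Ck_on_real_deriv(2)[OF I(1) normal_components_Ck] frenet_at(11)
    by (intro Ck_on_sum Ck_on_mult Ck_on_inverse curvature_Ck binormal_components_Ck I) force+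
  fix s assume s: "s \<in> I"
  have "(\<Sum>i\<in>UNIV. deriv (\<lambda>u. n u $ i) s * b s $ i) = dot n s \<bullet> b s" by (simp add: inner_vec_def)
  also have "\<dots> = \<kappa> s * H s"
    unfolding dot_frenet(2)[OF s] using components_orthonormal[OF s]
    by (simp add: inner_add_left inner_add_right inner_diff_left inner_diff_right dot_cross_self dot_cross inner_commute)
  finally show "(\<Sum>i\<in>UNIV. deriv (\<lambda>u. n u $ i) s * b s $ i) * inverse (\<kappa> s) = H s"
    using frenet_at(11)[OF s] by simp
qed

lemma components_frenet_system: "frenet_system I t n b \<kappa> H"
proof
  have dot: "(w has_vector_derivative dot w s) (at s)"
    if "\<And>i. Ck_on (Suc 0) I (\<lambda>s. w s $ i)" "s \<in> I" for w s
    by (rule has_vector_derivative_vec) (use Ck_on_real_deriv(1)[OF I(1) that] in simp)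
  fix s assume s: "s \<in> I"
  show "(t has_vector_derivative \<kappa> s *\<^sub>R n s) (at s)"
    using dot[OF tangent_components_Ck s] unfolding dot_frenet(1)[OF s] .
  show "(n has_vector_derivative - \<kappa> s *\<^sub>R t s + (\<kappa> s * H s) *\<^sub>R b s) (at s)"
    using dot[OF normal_components_Ck s] unfolding dot_frenet(2)[OF s] .
  show "(b has_vector_derivative - (\<kappa> s * H s) *\<^sub>R n s) (at s)"
    using dot[OF binormal_components_Ck s] unfolding dot_frenet(3)[OF s] .
  show "(H has_real_derivative deriv H s) (at s)"
    using Ck_on_real_deriv(1)[OF I(1) harmonic_curvature_Ck s] .
qed (use I components_orthonormal frenet_at(11) in auto)

text \<open>A left invariant field has constant components in the frame, so a slant helix is a curve whose \<open>n\<close> makes a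
  constant angle with a fixed vector of \<open>\<real>\<^sup>3\<close>.\<close>

lemma slant_helix_components:
  "slant_helix G \<A> m I \<alpha> N \<longleftrightarrow>
   (\<exists>x. x \<bullet> x = 1 \<and> (\<exists>\<theta>\<in>{0..pi}. \<theta> \<noteq> pi / 2 \<and> (\<forall>s\<in>I. n s \<bullet> x = cos \<theta>)))"
proof -
  have algebra: "X \<in> lie_algebra G \<A> \<longleftrightarrow> (\<exists>x. X = frame_of x)" for X
    using basis lincomb_lie_algebra[OF lie metric basis] unfolding orthonormal_basis_def by blast
  have inner: "m (\<alpha> s) (N s) (frame_of x (\<alpha> s)) = n s \<bullet> x" if "s \<in> I" for s x
    unfolding frame_expansion(2)[OF that] lincomb_inner' ..
  have angle: "(\<forall>s\<in>I. m (\<alpha> s) (N s) (frame_of x (\<alpha> s)) = y) \<longleftrightarrow> (\<forall>s\<in>I. n s \<bullet> x = y)" for x y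
    using inner by simp
  show ?thesis
    unfolding slant_helix_def Bex_def[of "lie_algebra G \<A>"] algebra ex_simps(1)[symmetric]
    by (subst ex_comm) (simp add: lie_inner_def lincomb_inner' angle)
qed

end

theorem theorem3p6:
  fixes G :: "'g::{t2_space,second_countable_topology} monoid"
    and \<A> :: "('g, real ^ 3) atlas"
    and m :: "'g \<Rightarrow> 'g tvec \<Rightarrow> 'g tvec \<Rightarrow> real"
    and D :: "'g vfield \<Rightarrow> 'g vfield \<Rightarrow> 'g vfield"
    and E :: "3 \<Rightarrow> 'g vfield"
    and I :: "real set"
    and \<alpha> :: "real \<Rightarrow> 'g"
    and T N B :: "real \<Rightarrow> 'g tvec"
    and \<kappa> \<tau> H :: "real \<Rightarrow> real"
  assumes "lie_group G \<A>"
    and "bi_invariant_metric G \<A> m"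
    and "levi_civita \<A> m D"
    and "orthonormal_basis G \<A> m E"
    and "open I" and "is_interval I" and "I \<noteq> {}"
    and "unit_speed_curve \<A> m I \<alpha>"
    and "frenet_apparatus \<A> m D E I \<alpha> T N B \<kappa> \<tau>"
    and "\<And>s. s \<in> I \<Longrightarrow> H s = (\<tau> s - group_torsion \<A> m E \<alpha> T N B s) / \<kappa> s"
  shows "slant_helix G \<A> m I \<alpha> N \<longleftrightarrow>
    (\<exists>\<theta>\<in>{0..pi}. \<theta> \<noteq> pi / 2 \<and>
      (\<forall>s\<in>I. deriv H s \<noteq> 0 \<and>
        \<kappa> s * (1 + (H s)\<^sup>2) powr (3/2) / deriv H s = tan \<theta>))"
proof -
  interpret frenet_curve_in_lie_group G \<A> m D E I \<alpha> T N B \<kappa> \<tau> H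
    using assms by (rule frenet_curve_in_lie_group.intro)
  show ?thesis
    unfolding slant_helix_components
    by (rule frenet_system.constant_angle_iff_slope[OF components_frenet_system])
qed

end
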